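(* Let $p$ be a prime and let $f\in\mathcal B$. Then $f$ is measure-preserving if and only if $f$ is bijective modulo $p^2$. Moreover, $f$ is ergodic if and only if $f$ is transitive modulo $p^2$ (when $p\notin\{2,3\}$), respectively transitive modulo $p^3$ (when $p\in\{2,3\}$).
   Context: $\mathbb Z_p$ denotes the $p$-adic integers with norm $\|\cdot\|_p$; $\binom{x}{i}=x(x-1)\cdots(x-i+1)/i!$. $\mathcal B$ is the set of functions $f\colon\mathbb Z_p\to\mathbb Z_p$ of the form $f(x)=\sum_{i\ge0}a_i\binom{x}{i}$ with $a_i/i!\in\mathbb Z_p$ for all $i$ (such series converge uniformly on $\mathbb Z_p$, and such $f$ are compatible, i.e. $\|f(x)-f(y)\|_p\le\|x-y\|_p$). $f$ is bijective (resp. transitive) modulo $p^k$ if $x\mapsto f(x)\bmod p^k$ induces a bijection (resp. a single-cycle permutation) of $\mathbb Z/p^k$. With $\mu$ the normalized Haar measure, $f$ is measure-preserving if $\mu(f^{-1}(U))=\mu(U)$ for all measurable $U$, and ergodic if moreover $f^{-1}(U)=U$ implies $\mu(U)\in\{0,1\}$; for compatible $f$ these are equivalent to $f$ being bijective, resp. transitive, modulo $p^k$ for every $k\ge1$. *)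

theory Defs
  imports
    "HOL-Probability.Probability"
    "HOL-Combinatorics.Orbits"
    "Berlekamp_Zassenhaus.Finite_Field"
begin

section \<open>The ring of p-adic integers\<close>

text \<open>The prime \<open>p\<close> is \<open>CARD('p)\<close> for a type \<open>'p\<close> of class \<open>prime_card\<close>, and the
  p-adic integers are the inverse limit of the rings \<open>\<int>/p\<^sup>k\<close>. The \<open>k\<close>-th component of an element
  (\<open>padic_residue x k\<close>) is its residue modulo \<open>p\<^sup>k\<close>, represented in \<open>{0..<p\<^sup>k}\<close>.\<close>

typedef ('p :: prime_card) padic_int =
  "{x :: nat \<Rightarrow> int. \<forall>k. x k \<in> {0..<int CARD('p) ^ k} \<and> x (Suc k) mod int CARD('p) ^ k = x k}"
  morphisms padic_residue Abs_padic_int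
proof -
  have "int CARD('p) > 0"
    using prime_gt_0_int[OF prime_card_int[where 'a = 'p]] by simp
  then show ?thesis by (intro exI[of _ "\<lambda>_. 0"]) simp
qed

setup_lifting type_definition_padic_int

lemma p_gt_1: "int CARD('p :: prime_card) > 1"
  using prime_gt_1_int[OF prime_card_int[where 'a = 'p]] by simp

lemma p_pow_pos [simp]: "int CARD('p :: prime_card) ^ k > 0"
  using p_gt_1[where 'p = 'p] by simp

lemma padic_residue_bounds:
  fixes x :: "'p :: prime_card padic_int"
  shows "0 \<le> padic_residue x k" "padic_residue x k < int CARD('p) ^ k"
  using padic_residue[of x] by auto

lemma padic_residue_Suc:
  fixes x :: "'p :: prime_card padic_int"
  shows "padic_residue x (Suc k) mod int CARD('p) ^ k = padic_residue x k"
  using padic_residue[of x] by auto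

lemma padic_residue_mod:
  fixes x :: "'p :: prime_card padic_int"
  assumes "j \<le> k"
  shows "padic_residue x k mod int CARD('p) ^ j = padic_residue x j"
  using assms
proof (induction k rule: dec_induct)
  case base
  then show ?case using padic_residue_bounds[of x j] by simp
next
  case (step n)
  have "int CARD('p) ^ j dvd int CARD('p) ^ n" using step by (simp add: le_imp_power_dvd)
  then have "padic_residue x (Suc n) mod int CARD('p) ^ n mod int CARD('p) ^ j
      = padic_residue x (Suc n) mod int CARD('p) ^ j" by (rule mod_mod_cancel)
  then show ?case using padic_residue_Suc[of x n] step by simp
qed

lemma padic_residue_mod_self [simp]:
  fixes x :: "'p :: prime_card padic_int"
  shows "padic_residue x k mod int CARD('p) ^ k = padic_residue x k"
  by (rule padic_residue_mod) simp

lemma padic_eqI: "(\<And>k. padic_residue x k = padic_residue y k) \<Longrightarrow> x = y"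
  by (simp add: padic_residue_inject[symmetric] fun_eq_iff)

lemma mod_Suc_pow_mod: "a mod (m * m ^ k) mod m ^ k = a mod (m ^ k :: int)"
  by (rule mod_mod_cancel) simp

instantiation padic_int :: (prime_card) comm_ring_1
begin

lift_definition zero_padic_int :: "'a padic_int" is "\<lambda>_. 0"
  by simp

lift_definition one_padic_int :: "'a padic_int" is "\<lambda>k. 1 mod int CARD('a) ^ k"
  by (simp add: mod_Suc_pow_mod)

lift_definition plus_padic_int :: "'a padic_int \<Rightarrow> 'a padic_int \<Rightarrow> 'a padic_int"
  is "\<lambda>x y k. (x k + y k) mod int CARD('a) ^ k"
  apply (simp add: mod_Suc_pow_mod)
  apply (metis mod_add_eq)
  done

lift_definition minus_padic_int :: "'a padic_int \<Rightarrow> 'a padic_int \<Rightarrow> 'a padic_int"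
  is "\<lambda>x y k. (x k - y k) mod int CARD('a) ^ k"
  apply (simp add: mod_Suc_pow_mod)
  apply (metis mod_diff_eq)
  done

lift_definition uminus_padic_int :: "'a padic_int \<Rightarrow> 'a padic_int"
  is "\<lambda>x k. (- x k) mod int CARD('a) ^ k"
  apply (simp add: mod_Suc_pow_mod)
  apply (metis mod_minus_eq)
  done

lift_definition times_padic_int :: "'a padic_int \<Rightarrow> 'a padic_int \<Rightarrow> 'a padic_int"
  is "\<lambda>x y k. (x k * y k) mod int CARD('a) ^ k"
  apply (simp add: mod_Suc_pow_mod)
  apply (metis mod_mult_eq)
  done

instance
proof
  fix a b c :: "'a padic_int"
  show "a * b * c = a * (b * c)"
    by transfer (simp add: mod_simps ac_simps)
  show "a * b = b * a"
    by transfer (simp add: ac_simps)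
  show "1 * a = a"
    by transfer (simp add: mod_simps fun_eq_iff)
  show "a + b + c = a + (b + c)"
    by transfer (simp add: mod_simps ac_simps)
  show "a + b = b + a"
    by transfer (simp add: ac_simps)
  show "0 + a = a"
    by transfer (simp add: fun_eq_iff)
  show "- a + a = 0"
    by transfer (simp add: mod_simps fun_eq_iff)
  show "a - b = a + - b"
    by transfer (simp add: mod_simps fun_eq_iff)
  show "(a + b) * c = a * c + b * c"
    by transfer (simp add: mod_simps fun_eq_iff algebra_simps)
  have "padic_residue (0 :: 'a padic_int) 1 \<noteq> padic_residue 1 1"
    using p_gt_1[where 'p = 'a] by transfer simp
  then show "(0 :: 'a padic_int) \<noteq> 1" by auto
qed

end

lemmas padic_residue_simps =
  zero_padic_int.rep_eq one_padic_int.rep_eq plus_padic_int.rep_eq minus_padic_int.rep_eq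
  uminus_padic_int.rep_eq times_padic_int.rep_eq

lemma padic_residue_of_nat:
  "padic_residue (of_nat n :: 'p :: prime_card padic_int) k = int n mod int CARD('p) ^ k"
  by (induction n) (simp_all add: padic_residue_simps mod_simps add.commute)

lemma padic_residue_of_int:
  "padic_residue (of_int n :: 'p :: prime_card padic_int) k = n mod int CARD('p) ^ k"
  by (cases n rule: int_cases2) (simp_all add: padic_residue_simps padic_residue_of_nat mod_simps)

lemma padic_residue_at_0 [simp]: "padic_residue x 0 = 0"
  using padic_residue_bounds[of x 0] by simp

lemma pow_p_gt: "int n < int CARD('p :: prime_card) ^ n"
proof -
  have "n < CARD('p) ^ n"
    using p_gt_1[where 'p = 'p] by (intro power_gt_expt) simp
  then show ?thesis by (metis of_nat_less_iff of_nat_power)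
qed

instance padic_int :: (prime_card) ring_char_0
proof
  show "inj (of_nat :: nat \<Rightarrow> 'a padic_int)"
  proof (rule injI)
    fix m n :: nat
    assume eq: "(of_nat m :: 'a padic_int) = of_nat n"
    define k where "k = max m n"
    have "int m mod int CARD('a) ^ k = int n mod int CARD('a) ^ k"
      using eq by (metis padic_residue_of_nat)
    moreover have "int m < int CARD('a) ^ k" "int n < int CARD('a) ^ k"
      using pow_p_gt[of k, where 'p = 'a] by (simp_all add: k_def)
    ultimately show "m = n" by simp
  qed
qed

text \<open>The p-adic valuation; its value at \<open>0\<close> is irrelevant.\<close>

definition padic_val :: "'p :: prime_card padic_int \<Rightarrow> nat" where
  "padic_val x = (LEAST k. padic_residue x (Suc k) \<noteq> 0)"

lemma padic_val_nz:
  assumes "x \<noteq> 0"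
  shows "padic_residue x (Suc (padic_val x)) \<noteq> 0" "padic_residue x (padic_val x) = 0"
proof -
  obtain k where k: "padic_residue x k \<noteq> 0"
    using assms padic_eqI[of x 0] by (auto simp: padic_residue_simps)
  then obtain k' where "k = Suc k'" by (cases k) auto
  with k show "padic_residue x (Suc (padic_val x)) \<noteq> 0"
    unfolding padic_val_def by (metis (mono_tags, lifting) LeastI)
  show "padic_residue x (padic_val x) = 0"
  proof (cases "padic_val x")
    case (Suc j)
    then have "\<not> padic_residue x (Suc j) \<noteq> 0"
      unfolding padic_val_def using not_less_Least lessI by metis
    then show ?thesis using Suc by simp
  qed simp
qed

lemma padic_residue_eq_0_mono:
  "padic_residue x k = 0 \<Longrightarrow> j \<le> k \<Longrightarrow> padic_residue x j = 0"
  using padic_residue_mod[of j k x] by simp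

lemma padic_residue_eq_0_iff:
  assumes "x \<noteq> 0"
  shows "padic_residue x k = 0 \<longleftrightarrow> k \<le> padic_val x"
  using padic_val_nz[OF assms] padic_residue_eq_0_mono[of x] not_less_eq_eq by blast

lemma padic_no_zero_divisors:
  fixes x y :: "'p :: prime_card padic_int"
  assumes x: "x \<noteq> 0" and y: "y \<noteq> 0"
  shows "x * y \<noteq> 0"
proof
  assume xy: "x * y = 0"
  let ?p = "int CARD('p)"
  define a b n where "a = padic_val x" and "b = padic_val y" and "n = Suc (a + b)"
  define X Y where "X = padic_residue x n" and "Y = padic_residue y n"
  have "X mod ?p ^ a = 0" "X mod ?p ^ Suc a \<noteq> 0" "Y mod ?p ^ b = 0" "Y mod ?p ^ Suc b \<noteq> 0"
    unfolding X_def Y_def n_def a_def b_def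
    using padic_val_nz[OF x] padic_val_nz[OF y]
    by (subst padic_residue_mod; simp)+
  then obtain X' Y' where X': "X = ?p ^ a * X'" and Y': "Y = ?p ^ b * Y'"
    by (meson dvdE mod_0_imp_dvd)
  have nd: "\<not> ?p dvd X'" "\<not> ?p dvd Y'"
    using \<open>X mod ?p ^ Suc a \<noteq> 0\<close> \<open>Y mod ?p ^ Suc b \<noteq> 0\<close> unfolding X' Y'
    by (auto simp: mult.commute)
  have "X * Y mod ?p ^ n = 0"
    using xy unfolding X_def Y_def by (metis times_padic_int.rep_eq zero_padic_int.rep_eq)
  then have "?p ^ (a + b) * ?p dvd ?p ^ (a + b) * (X' * Y')"
    unfolding X' Y' n_def by (auto simp: power_add ac_simps dest!: mod_0_imp_dvd)
  then have "?p dvd X' * Y'" using p_pow_pos[where 'p = 'p, of "a + b"]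
    by (subst (asm) dvd_mult_cancel_left) auto
  then show False using nd prime_card_int[where 'a = 'p] by (simp add: prime_dvd_mult_iff)
qed

instantiation padic_int :: (prime_card) idom_divide
begin

text \<open>Exact division; the value is \<open>0\<close> when there is no quotient.\<close>

definition divide_padic_int :: "'a padic_int \<Rightarrow> 'a padic_int \<Rightarrow> 'a padic_int" where
  "divide_padic_int x y = (if y \<noteq> 0 \<and> y dvd x then THE z. x = z * y else 0)"

instance
proof
  fix a b :: "'a padic_int"
  show nz: "a \<noteq> 0 \<Longrightarrow> b \<noteq> 0 \<Longrightarrow> a * b \<noteq> 0" for a b :: "'a padic_int"
    by (rule padic_no_zero_divisors)
  show "a div 0 = 0" by (simp add: divide_padic_int_def)
  assume b: "b \<noteq> 0"
  have "z = a" if "a * b = z * b" for z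
  proof -
    have "(z - a) * b = 0" using that by (simp add: algebra_simps)
    then show ?thesis using nz[of "z - a" b] b by auto
  qed
  then show "a * b div b = a"
    using b by (auto simp: divide_padic_int_def intro!: the_equality)
qed

end

section \<open>The p-adic metric\<close>

definition padic_norm :: "'p :: prime_card padic_int \<Rightarrow> real" where
  "padic_norm x = (if x = 0 then 0 else 1 / real CARD('p) ^ padic_val x)"

lemma padic_norm_le_iff:
  fixes x :: "'p :: prime_card padic_int"
  shows "padic_norm x \<le> 1 / real CARD('p) ^ k \<longleftrightarrow> padic_residue x k = 0"
proof (cases "x = 0")
  case False
  have p: "real CARD('p) > 1" using p_gt_1[where 'p = 'p] by simp
  have "padic_norm x \<le> 1 / real CARD('p) ^ k \<longleftrightarrow> real CARD('p) ^ k \<le> real CARD('p) ^ padic_val x"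
    using False p by (simp add: padic_norm_def field_simps)
  also have "\<dots> \<longleftrightarrow> k \<le> padic_val x" using p by simp
  finally show ?thesis using padic_residue_eq_0_iff[OF False] by simp
qed (simp add: padic_norm_def padic_residue_simps)

lemma padic_norm_diff_le_iff:
  fixes x y :: "'p :: prime_card padic_int"
  shows "padic_norm (x - y) \<le> 1 / real CARD('p) ^ k \<longleftrightarrow> padic_residue x k = padic_residue y k"
proof -
  have "padic_residue (x - y) k = 0 \<longleftrightarrow> padic_residue x k = padic_residue y k"
    using mod_eq_dvd_iff[of "padic_residue x k" "int CARD('p) ^ k" "padic_residue y k"]
    by (auto simp: padic_residue_simps)
  then show ?thesis by (simp add: padic_norm_le_iff)
qed

lemma padic_norm_cases:
  fixes x :: "'p :: prime_card padic_int"
  obtains "padic_norm x = 0" "x = 0" | k where "padic_norm x = 1 / real CARD('p) ^ k" "x \<noteq> 0"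
  by (cases "x = 0") (auto simp: padic_norm_def)

lemma padic_norm_minus_commute: "padic_norm (x - y) = padic_norm (y - (x :: 'p :: prime_card padic_int))"
proof -
  have "padic_norm (x - y) \<le> padic_norm (y - x)" for x y :: "'p padic_int"
  proof (cases "y - x" rule: padic_norm_cases)
    case 1
    then show ?thesis by (simp add: padic_norm_def)
  next
    case (2 k)
    then show ?thesis using padic_norm_diff_le_iff[of y x k] padic_norm_diff_le_iff[of x y k]
      by simp
  qed
  then show ?thesis by (meson order_antisym)
qed

lemma padic_norm_ultra: "padic_norm (x - y) \<le> max (padic_norm (x - z)) (padic_norm (z - (y :: 'p :: prime_card padic_int)))"
proof (cases "x = z \<or> z = y")
  case True
  then show ?thesis by (auto simp: padic_norm_def)
next
  case False
  then obtain a b where a: "padic_norm (x - z) = 1 / real CARD('p) ^ a" and b: "padic_norm (z - y) = 1 / real CARD('p) ^ b"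
    by (auto simp: padic_norm_def)
  have p: "real CARD('p) > 1" using p_gt_1[where 'p = 'p] by simp
  have le: "1 / real CARD('p) ^ a \<le> 1 / real CARD('p) ^ min a b"
     "1 / real CARD('p) ^ b \<le> 1 / real CARD('p) ^ min a b"
    using p by (simp_all add: field_simps)
  have "padic_residue x (min a b) = padic_residue z (min a b)"
       "padic_residue z (min a b) = padic_residue y (min a b)"
    using le a b by (simp_all add: padic_norm_diff_le_iff[symmetric])
  then have "padic_norm (x - y) \<le> 1 / real CARD('p) ^ min a b" by (simp add: padic_norm_diff_le_iff)
  then show ?thesis using a b by (auto simp: min_def split: if_splits)
qed

instantiation padic_int :: (prime_card) metric_space
begin

definition dist_padic_int :: "'a padic_int \<Rightarrow> 'a padic_int \<Rightarrow> real" where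
  "dist_padic_int x y = padic_norm (x - y)"

definition uniformity_padic_int :: "('a padic_int \<times> 'a padic_int) filter" where
  "uniformity_padic_int = (INF e\<in>{0 <..}. principal {(x, y). dist x y < e})"

definition open_padic_int :: "'a padic_int set \<Rightarrow> bool" where
  "open_padic_int U \<longleftrightarrow> (\<forall>x\<in>U. eventually (\<lambda>(x', y). x' = x \<longrightarrow> y \<in> U) uniformity)"

instance
proof
  fix x y z :: "'a padic_int"
  have nn: "padic_norm u \<ge> 0" for u :: "'a padic_int"
    by (simp add: padic_norm_def)
  show "dist x y = 0 \<longleftrightarrow> x = y"
    by (simp add: dist_padic_int_def padic_norm_def)
  show "dist x y \<le> dist x z + dist y z"
    using padic_norm_ultra[of x y z] nn[of "x - z"] nn[of "y - z"] padic_norm_minus_commute[of y z]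
    by (auto simp: dist_padic_int_def)
qed (simp_all add: uniformity_padic_int_def open_padic_int_def)

end

lemma padic_dist_le_iff:
  fixes x y :: "'p :: prime_card padic_int"
  shows "dist x y \<le> 1 / real CARD('p) ^ k \<longleftrightarrow> padic_residue x k = padic_residue y k"
  by (simp add: dist_padic_int_def padic_norm_diff_le_iff)

section \<open>Normalized Haar measure\<close>

definition normalized_haar :: "'p :: prime_card padic_int measure \<Rightarrow> bool" where
  "normalized_haar M \<longleftrightarrow> sets M = sets borel \<and> emeasure M UNIV = 1 \<and>
     (\<forall>a. \<forall>A\<in>sets M. emeasure M ((\<lambda>x. a + x) ` A) = emeasure M A)"

definition padic_haar :: "'p :: prime_card padic_int measure" where
  "padic_haar = (THE M. normalized_haar M)"

definition padic_cyl :: "nat \<Rightarrow> int \<Rightarrow> 'p :: prime_card padic_int set" where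
  "padic_cyl k r = {x. padic_residue x k = r}"

lemma padic_open_iff:
  fixes U :: "'p :: prime_card padic_int set"
  shows "open U \<longleftrightarrow> (\<forall>x\<in>U. \<exists>k. padic_cyl k (padic_residue x k) \<subseteq> U)"
proof -
  have p: "real CARD('p) > 1" using p_gt_1[where 'p = 'p] by simp
  have "(\<exists>e>0. \<forall>y. dist y x < e \<longrightarrow> y \<in> U) \<longleftrightarrow> (\<exists>k. padic_cyl k (padic_residue x k) \<subseteq> U)" for x
  proof
    assume "\<exists>e>0. \<forall>y. dist y x < e \<longrightarrow> y \<in> U"
    then obtain e where e: "e > 0" "\<And>y. dist y x < e \<Longrightarrow> y \<in> U" by blast
    obtain k where "(1 / real CARD('p)) ^ k < e"
      using real_arch_pow_inv[of e "1 / real CARD('p)"] e p by auto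
    then have "1 / real CARD('p) ^ k < e" by (simp add: power_divide)
    then have "padic_cyl k (padic_residue x k) \<subseteq> U"
      using e(2) by (auto simp: padic_cyl_def padic_dist_le_iff[symmetric])
    then show "\<exists>k. padic_cyl k (padic_residue x k) \<subseteq> U" by blast
  next
    assume "\<exists>k. padic_cyl k (padic_residue x k) \<subseteq> U"
    then obtain k where "padic_cyl k (padic_residue x k) \<subseteq> U" by blast
    then have "y \<in> U" if "dist y x < 1 / real CARD('p) ^ k" for y
      using that padic_dist_le_iff[of y x k] by (auto simp: padic_cyl_def)
    moreover have "1 / real CARD('p) ^ k > 0" using p by simp
    ultimately show "\<exists>e>0. \<forall>y. dist y x < e \<longrightarrow> y \<in> U" by blast
  qed
  then show ?thesis by (simp add: open_dist)
qed

lemma padic_cyl_Int: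
  assumes "j \<le> k"
  shows "padic_cyl j r \<inter> padic_cyl k s
    = (if s mod int CARD('p) ^ j = r then padic_cyl k s else ({} :: 'p :: prime_card padic_int set))"
  using padic_residue_mod[OF assms, where 'p = 'p] by (auto simp: padic_cyl_def)

lemma padic_cyl_empty: "padic_cyl k (- 1) = ({} :: 'p :: prime_card padic_int set)"
proof -
  have "padic_residue x k \<noteq> - 1" for x :: "'p padic_int" using padic_residue_bounds(1)[of x k] by simp
  then show ?thesis by (simp add: padic_cyl_def)
qed

lemma padic_cyl_0: "padic_cyl 0 0 = UNIV"
  by (auto simp: padic_cyl_def)

abbreviation padic_cyls :: "'p :: prime_card padic_int set set" where
  "padic_cyls \<equiv> range (\<lambda>(k, r). padic_cyl k r)"

lemma Int_stable_padic_cyls: "Int_stable (padic_cyls :: 'p :: prime_card padic_int set set)"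
proof (rule Int_stableI)
  fix A B :: "'p padic_int set"
  assume "A \<in> padic_cyls" "B \<in> padic_cyls"
  then obtain j r k s where AB: "A = padic_cyl j r" "B = padic_cyl k s" by auto
  have e: "{} \<in> (padic_cyls :: 'p padic_int set set)" "padic_cyl i t \<in> (padic_cyls :: 'p padic_int set set)" for i t
    using padic_cyl_empty[symmetric] by (force, force)
  show "A \<inter> B \<in> padic_cyls"
  proof (cases "j \<le> k")
    case True
    then show ?thesis unfolding AB padic_cyl_Int[OF True] using e by auto
  next
    case False
    then have "k \<le> j" by simp
    then show ?thesis unfolding AB Int_commute[of "padic_cyl j r"] padic_cyl_Int[OF \<open>k \<le> j\<close>] using e by auto
  qed
qed

lemma sets_borel_padic:
  "sets (borel :: 'p :: prime_card padic_int measure) = sigma_sets UNIV padic_cyls"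
proof -
  have "sigma_sets UNIV {S :: 'p padic_int set. open S} = sigma_sets UNIV padic_cyls"
  proof (rule sigma_sets_eqI)
    fix U :: "'p padic_int set"
    assume "U \<in> {S. open S}"
    then have U: "open U" by simp
    define I where "I = {kr. case_prod padic_cyl kr \<subseteq> U}"
    have "U = (\<Union>kr\<in>I. case_prod padic_cyl kr)"
    proof
      show "U \<subseteq> (\<Union>kr\<in>I. case_prod padic_cyl kr)"
      proof
        fix x assume "x \<in> U"
        then obtain k where "padic_cyl k (padic_residue x k) \<subseteq> U" using U padic_open_iff by blast
        then have "(k, padic_residue x k) \<in> I" by (simp add: I_def)
        then show "x \<in> (\<Union>kr\<in>I. case_prod padic_cyl kr)" by (force simp: padic_cyl_def)
      qed
    qed (auto simp: I_def)
    moreover have "(\<Union>kr\<in>I. case_prod padic_cyl kr) \<in> sigma_sets UNIV padic_cyls"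
      by (rule sigma_sets_UNION) (auto intro: sigma_sets.Basic)
    ultimately show "U \<in> sigma_sets UNIV padic_cyls" by simp
  next
    fix A :: "'p padic_int set"
    assume "A \<in> padic_cyls"
    then have "open A" by (auto simp: padic_open_iff padic_cyl_def)
    then show "A \<in> sigma_sets UNIV {S. open S}" by (simp add: sigma_sets.Basic)
  qed
  then show ?thesis by (simp add: borel_def)
qed

lemma padic_cyl_borel [measurable, simp]: "padic_cyl k r \<in> sets borel"
  unfolding sets_borel_padic by (rule sigma_sets.Basic) auto

lemma padic_cyl_out:
  assumes "r \<notin> {0..<int CARD('p) ^ k}"
  shows "padic_cyl k r = ({} :: 'p :: prime_card padic_int set)"
  using assms padic_residue_bounds[where 'p = 'p] by (auto simp: padic_cyl_def)

lemma padic_measure_eqI: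
  fixes M N :: "'p :: prime_card padic_int measure"
  assumes "sets M = sets borel" "sets N = sets borel" "emeasure M UNIV \<noteq> \<infinity>"
    and eq: "\<And>k r. r \<in> {0..<int CARD('p) ^ k} \<Longrightarrow> emeasure M (padic_cyl k r) = emeasure N (padic_cyl k r)"
  shows "M = N"
proof (rule measure_eqI_generator_eq[where E = padic_cyls and \<Omega> = UNIV and A = "\<lambda>_. UNIV"])
  fix X :: "'p padic_int set"
  assume "X \<in> padic_cyls"
  then obtain k r where X: "X = padic_cyl k r" by auto
  show "emeasure M X = emeasure N X"
    using eq[of r k] padic_cyl_out[of r k, where 'p = 'p] X
    by (cases "r \<in> {0..<int CARD('p) ^ k}") auto
next
  show "range (\<lambda>_ :: nat. UNIV :: 'p padic_int set) \<subseteq> padic_cyls"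
    using padic_cyl_0[symmetric] by force
qed (use assms in \<open>simp_all add: sets_borel_padic Int_stable_padic_cyls\<close>)

lemma padic_cyl_translate:
  fixes a :: "'p :: prime_card padic_int"
  assumes "r \<in> {0..<int CARD('p) ^ k}"
  shows "(\<lambda>x. x - a) -` padic_cyl k r = padic_cyl k ((r + padic_residue a k) mod int CARD('p) ^ k)"
proof -
  let ?q = "int CARD('p) ^ k"
  have "padic_residue (x - a) k = r \<longleftrightarrow> padic_residue x k = (r + padic_residue a k) mod ?q" for x
  proof
    assume *: "padic_residue (x - a) k = r"
    have "padic_residue x k = padic_residue ((x - a) + a) k" by simp
    also have "\<dots> = (r + padic_residue a k) mod ?q"
      unfolding plus_padic_int.rep_eq * ..
    finally show "padic_residue x k = (r + padic_residue a k) mod ?q" .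
  next
    assume *: "padic_residue x k = (r + padic_residue a k) mod ?q"
    have "padic_residue (x - a) k = r mod ?q"
      unfolding minus_padic_int.rep_eq * by (simp add: mod_simps)
    then show "padic_residue (x - a) k = r" using assms by simp
  qed
  then show ?thesis by (auto simp: padic_cyl_def)
qed

lemma padic_translate_image:
  fixes a :: "'p :: prime_card padic_int"
  shows "(\<lambda>x. a + x) ` A = (\<lambda>x. x - a) -` A"
  by (auto simp: image_iff) (metis add.commute diff_add_cancel)

lemma padic_measurable_translate [measurable]:
  "(\<lambda>x :: 'p :: prime_card padic_int. x - a) \<in> borel_measurable borel"
proof (rule measurable_sigma_sets[where \<Omega> = UNIV and A = padic_cyls])
  fix y :: "'p padic_int set"
  assume "y \<in> padic_cyls"
  then obtain k r where y: "y = padic_cyl k r" by auto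
  show "(\<lambda>x. x - a) -` y \<inter> space borel \<in> sets borel"
    using padic_cyl_translate[of r k a] padic_cyl_out[of r k, where 'p = 'p] y
    by (cases "r \<in> {0..<int CARD('p) ^ k}") auto
qed (simp_all add: sets_borel_padic)

lemma haar_cyl:
  fixes M :: "'p :: prime_card padic_int measure"
  assumes M: "normalized_haar M" and r: "r \<in> {0..<int CARD('p) ^ k}"
  shows "emeasure M (padic_cyl k r) = 1 / of_nat (CARD('p) ^ k)"
proof -
  let ?q = "int CARD('p) ^ k"
  have sets: "sets M = sets borel" and one: "emeasure M UNIV = 1"
    and inv: "\<And>a A. A \<in> sets M \<Longrightarrow> emeasure M ((\<lambda>x. a + x) ` A) = emeasure M A"
    using M by (auto simp: normalized_haar_def)
  have eq: "emeasure M (padic_cyl k s) = emeasure M (padic_cyl k 0)" if s: "s \<in> {0..<?q}" for s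
  proof -
    have "(\<lambda>x. of_int s + x) ` padic_cyl k 0 = (padic_cyl k s :: 'p padic_int set)"
      unfolding padic_translate_image using s
      by (subst padic_cyl_translate) (simp_all add: padic_residue_of_int)
    then show ?thesis using inv[of "padic_cyl k 0" "of_int s"] sets by simp
  qed
  have "(\<Union>s\<in>{0..<?q}. padic_cyl k s) = (UNIV :: 'p padic_int set)"
    using padic_residue_bounds[where 'p = 'p] by (auto simp: padic_cyl_def)
  then have "1 = emeasure M (\<Union>s\<in>{0..<?q}. padic_cyl k s)" using one by simp
  also have "\<dots> = (\<Sum>s\<in>{0..<?q}. emeasure M (padic_cyl k s))"
  proof (rule sum_emeasure[symmetric])
    show "disjoint_family_on (padic_cyl k :: int \<Rightarrow> 'p padic_int set) {0..<?q}"
      by (auto simp: disjoint_family_on_def padic_cyl_def)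
  qed (auto simp: sets)
  also have "\<dots> = (\<Sum>s\<in>{0..<?q}. emeasure M (padic_cyl k r))"
    by (rule sum.cong[OF refl]) (rule trans[OF eq eq[OF r, symmetric]])
  also have "\<dots> = of_nat (CARD('p) ^ k) * emeasure M (padic_cyl k r)"
    by (simp add: nat_power_eq)
  finally have *: "of_nat (CARD('p) ^ k) * emeasure M (padic_cyl k r) = 1" by simp
  have nz: "(of_nat (CARD('p) ^ k) :: ennreal) \<noteq> 0" using p_gt_1[where 'p = 'p] by simp
  have nt: "(of_nat (CARD('p) ^ k) :: ennreal) \<noteq> top_class.top" using ennreal_of_nat_neq_top by blast
  have "emeasure M (padic_cyl k r) = of_nat (CARD('p) ^ k) * emeasure M (padic_cyl k r) / of_nat (CARD('p) ^ k)"
    using ennreal_mult_divide_eq[OF nz nt] by (metis mult.commute)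
  then show ?thesis using * by simp
qed

text \<open>Existence, through the law of a sequence of independent uniform digits.\<close>

lemma digit_sum_bounds:
  fixes p :: int assumes "p > 0"
  shows "(\<Sum>i<k. (d i mod p) * p ^ i) \<in> {0..<p ^ k}"
proof (induction k)
  case (Suc k)
  have "(d k mod p) * p ^ k \<le> (p - 1) * p ^ k" using assms by (intro mult_right_mono) auto
  moreover have "(d k mod p) * p ^ k \<ge> 0" using assms by simp
  ultimately show ?case using Suc by (auto simp: algebra_simps)
qed simp

lemma digit_sum_eq_iff:
  fixes p :: int assumes p: "p > 0" and "r \<in> {0..<p ^ k}"
  shows "(\<Sum>i<k. (d i mod p) * p ^ i) = r \<longleftrightarrow> (\<forall>i<k. d i mod p = r div p ^ i mod p)"
  using assms(2)
proof (induction k arbitrary: r)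
  case (Suc k)
  let ?S = "\<Sum>i<k. (d i mod p) * p ^ i"
  have S: "?S \<in> {0..<p ^ k}" by (rule digit_sum_bounds[OF p])
  have rk: "r div p ^ k mod p = r div p ^ k"
  proof -
    have "r div p ^ k * p ^ k = r - r mod p ^ k" by (rule minus_mod_eq_div_mult[symmetric])
    also have "\<dots> \<le> r" using p by simp
    also have "\<dots> < p * p ^ k" using Suc.prems by simp
    finally have "r div p ^ k < p" using p by simp
    moreover have "0 \<le> r div p ^ k" using Suc.prems p by (simp add: pos_imp_zdiv_nonneg_iff)
    ultimately show ?thesis by simp
  qed
  have "?S + (d k mod p) * p ^ k = r \<longleftrightarrow> ?S = r mod p ^ k \<and> d k mod p = r div p ^ k"
  proof
    assume *: "?S + (d k mod p) * p ^ k = r"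
    have "r mod p ^ k = ?S" "r div p ^ k = d k mod p"
      unfolding *[symmetric] using S p by simp_all
    then show "?S = r mod p ^ k \<and> d k mod p = r div p ^ k" by simp
  next
    assume "?S = r mod p ^ k \<and> d k mod p = r div p ^ k"
    then show "?S + (d k mod p) * p ^ k = r" by (simp only: mod_div_mult_eq)
  qed
  also have "?S = r mod p ^ k \<longleftrightarrow> (\<forall>i<k. d i mod p = (r mod p ^ k) div p ^ i mod p)"
    using p by (intro Suc.IH) simp
  also have "\<dots> \<longleftrightarrow> (\<forall>i<k. d i mod p = r div p ^ i mod p)"
  proof (intro all_cong1 imp_cong refl)
    fix i assume i: "i < k"
    have "p ^ k = p ^ i * p ^ (k - i)" using i by (simp flip: power_add)
    then have "r mod p ^ k = p ^ i * (r div p ^ i mod p ^ (k - i)) + r mod p ^ i"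
      using p by (metis zmod_zmult2_eq zero_le_power less_imp_le)
    then have "(r mod p ^ k) div p ^ i = r div p ^ i mod p ^ (k - i)"
      using p by simp
    moreover have "p dvd p ^ (k - i)" using i by simp
    ultimately have "(r mod p ^ k) div p ^ i mod p = r div p ^ i mod p"
      by (simp add: mod_mod_cancel)
    then show "(d i mod p = (r mod p ^ k) div p ^ i mod p) = (d i mod p = r div p ^ i mod p)" by simp
  qed
  finally show ?case using rk by (auto simp: less_Suc_eq)
qed simp

lift_definition padic_of_digits :: "(nat \<Rightarrow> int) \<Rightarrow> 'p :: prime_card padic_int" is
  "\<lambda>d k. \<Sum>i<k. (d i mod int CARD('p)) * int CARD('p) ^ i"
  subgoal for d
    using digit_sum_bounds[of "int CARD('p)" d] p_gt_1[where 'p = 'p] by auto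
  done

lemma ex_haar: "\<exists>M :: 'p :: prime_card padic_int measure. normalized_haar M"
proof -
  let ?p = "int CARD('p)"
  let ?U = "uniform_count_measure {0..<?p}"
  let ?P = "PiM (UNIV :: nat set) (\<lambda>_. ?U)"
  have p: "?p > 0" using p_gt_1[where 'p = 'p] by simp
  interpret U: prob_space ?U using p by (intro prob_space_uniform_count_measure) auto
  interpret P: product_prob_space "\<lambda>_ :: nat. ?U" UNIV ..
  define T :: "(nat \<Rightarrow> int) \<Rightarrow> 'p padic_int" where "T = padic_of_digits"
  have pre: "T -` padic_cyl k r \<inter> space ?P
      = prod_emb UNIV (\<lambda>_. ?U) {..<k} (Pi\<^sub>E {..<k} (\<lambda>i. {r div ?p ^ i mod ?p}))"
    if r: "r \<in> {0..<?p ^ k}" for k r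
  proof -
    have "d \<in> T -` padic_cyl k r \<longleftrightarrow> (\<forall>i<k. d i = r div ?p ^ i mod ?p)"
      if d: "\<And>i. d i \<in> {0..<?p}" for d
    proof -
      have "d i mod ?p = d i" for i using d[of i] by simp
      then show ?thesis using digit_sum_eq_iff[OF p r, of d]
        by (simp add: T_def padic_cyl_def padic_of_digits.rep_eq)
    qed
    then show ?thesis
      by (auto simp: prod_emb_def space_PiM space_uniform_count_measure PiE_iff restrict_def
          extensional_def)
  qed
  have in_sets: "{r div ?p ^ i mod ?p} \<in> sets ?U" for r i
    using p by (simp add: sets_uniform_count_measure)
  have T: "T \<in> measurable ?P borel"
  proof (rule measurable_sigma_sets[where \<Omega> = UNIV and A = padic_cyls])
    fix y :: "'p padic_int set"
    assume "y \<in> padic_cyls"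
    then obtain k r where y: "y = padic_cyl k r" by auto
    show "T -` y \<inter> space ?P \<in> sets ?P"
    proof (cases "r \<in> {0..<?p ^ k}")
      case True
      show ?thesis unfolding y pre[OF True] using in_sets
        by (intro sets_PiM_I) auto
    next
      case False
      then show ?thesis using padic_cyl_out[OF False] y by simp
    qed
  qed (simp_all add: sets_borel_padic)
  define M where "M = distr ?P borel T"
  have sM: "sets M = sets borel" by (simp add: M_def)
  have cyl: "emeasure M (padic_cyl k r) = (ennreal (1 / real CARD('p))) ^ k"
    if r: "r \<in> {0..<?p ^ k}" for k r
  proof -
    have "emeasure M (padic_cyl k r)
        = emeasure ?P (prod_emb UNIV (\<lambda>_. ?U) {..<k} (Pi\<^sub>E {..<k} (\<lambda>i. {r div ?p ^ i mod ?p})))"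
      unfolding M_def by (subst emeasure_distr[OF T]) (simp_all only: pre[OF r] padic_cyl_borel)
    also have "\<dots> = (\<Prod>i\<in>{..<k}. emeasure ?U {r div ?p ^ i mod ?p})"
      using in_sets by (intro P.emeasure_PiM_emb) auto
    also have "\<dots> = (\<Prod>i\<in>{..<k}. ennreal (1 / real CARD('p)))"
      using p by (intro prod.cong refl) (subst emeasure_uniform_count_measure, auto)
    finally show ?thesis by simp
  qed
  have one: "emeasure M UNIV = 1"
    using cyl[of 0 0] by (simp add: padic_cyl_0)
  have "emeasure M ((\<lambda>x. a + x) ` A) = emeasure M A" if A: "A \<in> sets M" for a A
  proof -
    define N where "N = distr M borel (\<lambda>x. x - a)"
    have ta: "(\<lambda>x. x - a) \<in> measurable M borel"
      using padic_measurable_translate[of a] measurable_cong_sets[OF sM refl] by blast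
    have sp: "space M = UNIV" using sets_eq_imp_space_eq[OF sM] by simp
    have N: "emeasure N B = emeasure M ((\<lambda>x. x - a) -` B)" if "B \<in> sets borel" for B
      unfolding N_def using that sp by (subst emeasure_distr[OF ta]) simp_all
    have "M = N"
    proof (rule padic_measure_eqI[OF sM])
      show "sets N = sets borel" by (simp add: N_def)
      show "emeasure M UNIV \<noteq> \<infinity>" using one by simp
      fix k r assume r: "r \<in> {0..<?p ^ k}"
      have "emeasure N (padic_cyl k r) = emeasure M (padic_cyl k ((r + padic_residue a k) mod ?p ^ k))"
        by (simp add: N padic_cyl_translate[OF r])
      also have "\<dots> = ennreal (1 / real CARD('p)) ^ k" by (rule cyl) simp
      finally show "emeasure M (padic_cyl k r) = emeasure N (padic_cyl k r)" using cyl[OF r] by simp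
    qed
    then show ?thesis using N[of A] A sM unfolding padic_translate_image by simp
  qed
  then have "normalized_haar M" using sM one by (simp add: normalized_haar_def)
  then show ?thesis by blast
qed

lemma ex1_haar: "\<exists>!M :: 'p :: prime_card padic_int measure. normalized_haar M"
proof (rule ex_ex1I[OF ex_haar])
  fix M N :: "'p padic_int measure"
  assume "normalized_haar M" "normalized_haar N"
  then show "M = N"
    by (intro padic_measure_eqI) (simp_all add: haar_cyl, simp_all add: normalized_haar_def)
qed

lemma normalized_haar_padic_haar: "normalized_haar padic_haar"
  unfolding padic_haar_def by (rule theI'[OF ex1_haar])

definition measure_preserving :: "('p :: prime_card padic_int \<Rightarrow> 'p padic_int) \<Rightarrow> bool" where
  "measure_preserving f \<longleftrightarrow> f \<in> measurable padic_haar padic_haar \<and>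
     (\<forall>U\<in>sets padic_haar. measure padic_haar (f -` U) = measure padic_haar U)"

definition ergodic :: "('p :: prime_card padic_int \<Rightarrow> 'p padic_int) \<Rightarrow> bool" where
  "ergodic f \<longleftrightarrow> measure_preserving f \<and>
     (\<forall>U\<in>sets padic_haar. f -` U = U \<longrightarrow> measure padic_haar U \<in> {0, 1})"

section \<open>Maps modulo powers of p and the class B\<close>

definition induces_mod ::
  "('p :: prime_card padic_int \<Rightarrow> 'p padic_int) \<Rightarrow> nat \<Rightarrow> (int \<Rightarrow> int) \<Rightarrow> bool" where
  "induces_mod f k g \<longleftrightarrow> (\<forall>x. padic_residue (f x) k = g (padic_residue x k))"

definition bijective_mod :: "('p :: prime_card padic_int \<Rightarrow> 'p padic_int) \<Rightarrow> nat \<Rightarrow> bool" where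
  "bijective_mod f k \<longleftrightarrow>
     (\<exists>g. induces_mod f k g \<and> bij_betw g {0..<int CARD('p) ^ k} {0..<int CARD('p) ^ k})"

definition transitive_mod :: "('p :: prime_card padic_int \<Rightarrow> 'p padic_int) \<Rightarrow> nat \<Rightarrow> bool" where
  "transitive_mod f k \<longleftrightarrow>
     (\<exists>g. induces_mod f k g \<and> bij_betw g {0..<int CARD('p) ^ k} {0..<int CARD('p) ^ k} \<and>
       cyclic_on g {0..<int CARD('p) ^ k})"

text \<open>The division is exact: \<open>i!\<close> divides \<open>x (x - 1) \<dots> (x - i + 1)\<close> in the p-adic integers. The
  formula is that of \<open>gchoose\<close>, which the library restricts to fields.\<close>

definition padic_binom :: "'p :: prime_card padic_int \<Rightarrow> nat \<Rightarrow> 'p padic_int" where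
  "padic_binom x i = (\<Prod>j=0..<i. x - of_nat j) div fact i"

text \<open>\<open>a\<^sub>i / i! \<in> \<int>\<^sub>p\<close> is divisibility of \<open>a\<^sub>i\<close> by \<open>i!\<close> in the p-adic integers.\<close>

definition padic_B :: "('p :: prime_card padic_int \<Rightarrow> 'p padic_int) set" where
  "padic_B = {f. \<exists>a. (\<forall>i. fact i dvd a i) \<and> (\<forall>x. (\<lambda>i. a i * padic_binom x i) sums f x)}"

end

theory Submission
  imports Defs "HOL-Number_Theory.Number_Theory"
begin

text \<open>Since \<open>i!\<close> divides \<open>x (x - 1) \<dots> (x - i + 1)\<close>, a function in B acts modulo \<open>p\<^sup>k\<close> as an
  integer polynomial \<open>P\<close>. Bijectivity modulo \<open>p\<^sup>2\<close> says that \<open>P\<close> is injective modulo \<open>p\<close> and that \<open>P'\<close>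
  has no zero modulo \<open>p\<close>, which makes \<open>P\<close> injective modulo every \<open>p\<^sup>k\<close>.

  Transitivity modulo \<open>m\<close> says that the orbit of \<open>0\<close> returns to \<open>0\<close> modulo \<open>m\<close> exactly at the
  multiples of \<open>m\<close>. If this holds for \<open>m = M = p\<^sup>n\<close>, then \<open>P\<^sup>M(M t) = M S(t)\<close> for a map \<open>S\<close>, and \<open>P\<close> is
  transitive modulo \<open>M m\<close> if and only if \<open>S\<close> is transitive modulo \<open>m\<close>. If \<open>S\<close> is transitive modulo \<open>p\<close>,
  then modulo \<open>p\<^sup>2\<close> it has the form \<open>t \<mapsto> t + c + p (a t + q t\<^sup>2)\<close>, so that
  \<open>S\<^sup>j(0) = c j + p (a c s\<^sub>1(j) + q c\<^sup>2 s\<^sub>2(j))\<close>, where \<open>s\<^sub>1\<close> and \<open>s\<^sub>2\<close> are the sums of the numbers and of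
  the squares below \<open>j\<close>. The denominators \<open>2\<close> and \<open>6\<close> of these sums are what makes the primes \<open>2\<close>
  and \<open>3\<close> exceptional.

  On the measure side, the maps induced modulo \<open>p\<^sup>k\<close> describe the action on cylinders, and cylinders
  determine finite Borel measures. Under a transitive action an invariant set is independent of every
  cylinder, and so of itself.\<close>

section \<open>Orbits and iterates\<close>

lemma bij_betw_in_invariant_subset_iff:
  assumes g: "bij_betw g S S" and "finite S" and T: "T \<subseteq> S" "g ` T \<subseteq> T" and "r \<in> S"
  shows "g r \<in> T \<longleftrightarrow> r \<in> T"
proof -
  have "inj_on g S" using g by (rule bij_betw_imp_inj_on)
  then have "g ` T = T"
    using T \<open>finite S\<close> by (intro endo_inj_surj) (auto intro: finite_subset inj_on_subset)
  then show ?thesis using inj_on_image_mem_iff[OF \<open>inj_on g S\<close> \<open>r \<in> S\<close> T(1)] by simp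
qed

lemma cyclic_on_image_eq:
  assumes "cyclic_on f S"
  shows "f ` S = S"
proof
  show "f ` S \<subseteq> S" using cyclic_on_inI[OF assms] by blast
  show "S \<subseteq> f ` S"
  proof
    fix s assume "s \<in> S"
    then have "S = orbit f s" using orbit_cyclic_eq3[OF assms] by simp
    with \<open>s \<in> S\<close> have "s \<in> orbit f s" by simp
    then show "s \<in> f ` S" by cases (use \<open>s \<in> S\<close> \<open>S = orbit f s\<close> in auto)
  qed
qed

lemma funpow_eq_self_iff_card_orbit_dvd:
  assumes "s \<in> orbit f s"
  shows "(f ^^ i) s = s \<longleftrightarrow> card (orbit f s) dvd i"
proof -
  define n where "n = funpow_dist1 f s s"
  have "orbit f s = (\<lambda>i. (f ^^ i) s) ` {0..<n}"
    unfolding n_def by (rule orbit_conv_funpow_dist1[OF assms])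
  moreover have "inj_on (\<lambda>i. (f ^^ i) s) {0..<n}"
    unfolding n_def by (rule inj_on_funpow_dist1[OF assms])
  ultimately have card: "card (orbit f s) = n" by (simp add: card_image)
  have n: "n > 0" "(f ^^ n) s = s"
    unfolding n_def using funpow_dist1_prop[OF assms] by simp_all
  have "(f ^^ i) s = (f ^^ (i mod n)) s" using funpow_mod_eq[OF n(2)] by metis
  also have "\<dots> = s \<longleftrightarrow> i mod n = 0"
    using funpow_dist1_least[of "i mod n" f s s] n(1) by (auto simp flip: n_def)
  finally show ?thesis by (simp add: card dvd_eq_mod_eq_0)
qed

lemma cyclic_on_iff_return_times:
  assumes S: "finite S" "f ` S \<subseteq> S" "s \<in> S"
  shows "cyclic_on f S \<longleftrightarrow> (\<forall>i. (f ^^ i) s = s \<longleftrightarrow> card S dvd i)"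
proof
  assume "cyclic_on f S"
  then have "orbit f s = S" using S(3) by (rule orbit_cyclic_eq3)
  then show "\<forall>i. (f ^^ i) s = s \<longleftrightarrow> card S dvd i"
    using funpow_eq_self_iff_card_orbit_dvd[of s f] S(3) by simp
next
  assume return: "\<forall>i. (f ^^ i) s = s \<longleftrightarrow> card S dvd i"
  have "card S > 0" using S by (auto simp: card_gt_0_iff)
  moreover have "(f ^^ card S) s = s" using return by simp
  ultimately have self: "s \<in> orbit f s" unfolding orbit_altdef by (metis (mono_tags) mem_Collect_eq)
  have "(f ^^ i) s \<in> S" for i using S by (induction i) auto
  then have "orbit f s \<subseteq> S" by (auto simp: orbit_altdef)
  moreover have "card (orbit f s) = card S"
    using return funpow_eq_self_iff_card_orbit_dvd[OF self] by (meson dvd_antisym dvd_refl)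
  ultimately have "orbit f s = S" using S(1) by (simp add: card_subset_eq)
  then show "cyclic_on f S" using S(3) by (auto intro: cyclic_on_singleI)
qed

definition full_period :: "(int \<Rightarrow> int) \<Rightarrow> nat \<Rightarrow> bool" where
  "full_period F m \<longleftrightarrow> (\<forall>i. int m dvd (F ^^ i) 0 \<longleftrightarrow> m dvd i)"

lemma cyclic_on_mod_iff_full_period:
  assumes "m > 0" and cong: "\<And>x y. [x = y] (mod int m) \<Longrightarrow> [F x = F y] (mod int m)"
  shows "cyclic_on (\<lambda>r. F r mod int m) {0..<int m} \<longleftrightarrow> full_period F m"
proof -
  define g where "g = (\<lambda>r. F r mod int m)"
  have "(g ^^ i) 0 = (F ^^ i) 0 mod int m" for i
  proof (induction i)
    case (Suc i)
    then show ?case using cong[of "(F ^^ i) 0 mod int m" "(F ^^ i) 0"] by (simp add: g_def cong_def)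
  qed simp
  moreover have "cyclic_on g {0..<int m} \<longleftrightarrow> (\<forall>i. (g ^^ i) 0 = 0 \<longleftrightarrow> card {0..<int m} dvd i)"
    using \<open>m > 0\<close> by (intro cyclic_on_iff_return_times) (auto simp: g_def)
  ultimately show ?thesis by (simp add: g_def full_period_def dvd_eq_mod_eq_0)
qed

lemma full_period_rescale:
  assumes "M > 0" and period: "full_period F M"
    and rescale: "\<And>t. (F ^^ M) (int M * t) = int M * S t"
  shows "full_period F (M * m) \<longleftrightarrow> full_period S m"
proof -
  have iterate: "(F ^^ (M * j)) 0 = int M * (S ^^ j) 0" for j
    by (induction j) (simp_all add: funpow_add rescale)
  have multiple: "int (M * m) dvd (F ^^ (M * j)) 0 \<longleftrightarrow> int m dvd (S ^^ j) 0"
    "M * m dvd M * j \<longleftrightarrow> m dvd j" for j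
    using \<open>M > 0\<close> by (simp_all add: iterate)
  have "M dvd i" if "int (M * m) dvd (F ^^ i) 0 \<or> M * m dvd i" for i
    using that period by (auto simp: full_period_def dest: dvd_mult_left)
  then have "full_period F (M * m)
      \<longleftrightarrow> (\<forall>j. int (M * m) dvd (F ^^ (M * j)) 0 \<longleftrightarrow> M * m dvd M * j)"
    unfolding full_period_def by (metis dvdE)
  also have "\<dots> \<longleftrightarrow> full_period S m" unfolding multiple full_period_def ..
  finally show ?thesis .
qed

lemma fermat_cong_int:
  fixes a :: int
  assumes "prime p"
  shows "[a ^ p = a] (mod int p)"
proof (cases "int p dvd a")
  case True
  moreover have "int p dvd a ^ p"
    using dvd_trans[OF True dvd_power] assms by (simp add: prime_gt_0_nat)
  ultimately show ?thesis by (simp add: cong_def dvd_eq_mod_eq_0)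
next
  case False
  have "residues (int p)" using prime_gt_1_nat[OF assms] by (simp add: residues_def)
  moreover have "coprime a (int p)"
    using False assms prime_imp_coprime[of "int p" a] by (simp add: coprime_commute)
  ultimately have "[a ^ (p - 1) = 1] (mod int p)"
    using residues.euler_theorem[of "int p" a] assms by (simp add: totient_prime)
  then have "[a * a ^ (p - 1) = a * 1] (mod int p)" by (intro cong_mult cong_refl)
  then show ?thesis using assms by (simp add: power_eq_if prime_gt_0_nat)
qed

lemma affine_full_period_mod_prime:
  fixes a c :: int
  assumes p: "prime p" and period: "full_period F p"
    and affine: "\<And>x. [F x = c + a * x] (mod int p)"
  shows "\<not> int p dvd c" "[a = 1] (mod int p)"
proof -
  have "\<not> int p dvd F 0"
    using period[unfolded full_period_def, rule_format, of 1] p by (auto dest: prime_gt_1_nat)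
  then show c: "\<not> int p dvd c" using cong_dvd_iff[OF affine[of 0]] by simp
  have "[(a - 1) * (F ^^ j) 0 = c * (a ^ j - 1)] (mod int p)" for j
  proof (induction j)
    case (Suc j)
    have "[(a - 1) * F ((F ^^ j) 0) = (a - 1) * (c + a * (F ^^ j) 0)] (mod int p)"
      by (intro cong_mult cong_refl affine)
    also have "(a - 1) * (c + a * (F ^^ j) 0) = (a - 1) * c + a * ((a - 1) * (F ^^ j) 0)"
      by (simp add: algebra_simps)
    also have "[\<dots> = (a - 1) * c + a * (c * (a ^ j - 1))] (mod int p)"
      by (intro cong_add cong_mult cong_refl Suc)
    also have "(a - 1) * c + a * (c * (a ^ j - 1)) = c * (a ^ Suc j - 1)"
      by (simp add: algebra_simps)
    finally show ?case by simp
  qed simp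
  from cong_dvd_iff[OF this, of p] have "int p dvd c * (a ^ p - 1)"
    using period by (simp add: full_period_def)
  then have "[a ^ p = 1] (mod int p)"
    using c p by (simp add: prime_dvd_mult_iff cong_iff_dvd_diff)
  then show "[a = 1] (mod int p)" using fermat_cong_int[OF p] cong_sym cong_trans by blast
qed

lemma prime_dvd_sum_lessThan:
  assumes p: "prime p" "p \<noteq> 2" and "p dvd j"
  shows "int p dvd (\<Sum>i<j. int i)"
proof -
  have "2 * (\<Sum>i<j. int i) = int j * (int j - 1)"
    by (induction j) (simp_all add: algebra_simps)
  then have "int p dvd 2 * (\<Sum>i<j. int i)" using \<open>p dvd j\<close> by simp
  moreover have "\<not> int p dvd 2"
    using p primes_dvd_imp_eq[of p 2] two_is_prime_nat int_dvd_int_iff[of p 2] by auto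
  ultimately show ?thesis using p by (simp add: prime_dvd_mult_iff)
qed

lemma prime_dvd_sum_squares_lessThan:
  assumes p: "prime p" "p > 3" and "p dvd j"
  shows "int p dvd (\<Sum>i<j. (int i)\<^sup>2)"
proof -
  have "6 * (\<Sum>i<j. (int i)\<^sup>2) = int j * ((int j - 1) * (2 * int j - 1))"
    by (induction j) (simp_all add: algebra_simps power2_eq_square)
  then have "int p dvd (2 * 3) * (\<Sum>i<j. (int i)\<^sup>2)" using \<open>p dvd j\<close> by simp
  moreover have "\<not> int p dvd 2" "\<not> int p dvd 3" using p(2) by (auto dest: zdvd_imp_le)
  ultimately show ?thesis using p(1) by (metis prime_dvd_mult_iff prime_nat_int_transfer)
qed

lemma quadratic_iterate_expansion:
  fixes p a c q :: int
  assumes F: "\<And>x. [F x = x + c + p * (a * x + q * x\<^sup>2)] (mod p\<^sup>2)"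
  shows "[(F ^^ j) 0 = c * int j + p * (a * c * (\<Sum>i<j. int i) + q * c\<^sup>2 * (\<Sum>i<j. (int i)\<^sup>2))]
    (mod p\<^sup>2)" (is "[_ = ?t j] (mod _)")
proof (induction j)
  case (Suc j)
  define w where "w = a * c * (\<Sum>i<j. int i) + q * c\<^sup>2 * (\<Sum>i<j. (int i)\<^sup>2)"
  have t: "?t j = c * int j + p * w" by (simp add: w_def)
  have "[F ((F ^^ j) 0) = (F ^^ j) 0 + c + p * (a * (F ^^ j) 0 + q * ((F ^^ j) 0)\<^sup>2)] (mod p\<^sup>2)"
    by (rule F)
  also have "[(F ^^ j) 0 + c + p * (a * (F ^^ j) 0 + q * ((F ^^ j) 0)\<^sup>2)
      = ?t j + c + p * (a * ?t j + q * (?t j)\<^sup>2)] (mod p\<^sup>2)"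
    by (intro cong_add cong_mult cong_pow cong_refl Suc)
  also have "?t j + c + p * (a * ?t j + q * (?t j)\<^sup>2)
      = ?t (Suc j) + p\<^sup>2 * (a * w + q * (2 * c * int j * w + p * w\<^sup>2))"
    unfolding t by (simp add: w_def algebra_simps power2_eq_square)
  also have "[?t (Suc j) + p\<^sup>2 * (a * w + q * (2 * c * int j * w + p * w\<^sup>2)) = ?t (Suc j)] (mod p\<^sup>2)"
    by (simp add: cong_def)
  finally show ?case by simp
qed simp

lemma quadratic_full_period_prime_square:
  fixes a c q :: int
  assumes p: "prime p" and period: "full_period F p" and c: "\<not> int p dvd c"
    and F: "\<And>x. [F x = x + c + int p * (a * x + q * x\<^sup>2)] (mod (int p)\<^sup>2)"
    and a: "p \<noteq> 2 \<or> int p dvd a" and q: "p > 3 \<or> int p dvd q"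
  shows "full_period F (p\<^sup>2)"
  unfolding full_period_def
proof
  fix j
  show "int (p\<^sup>2) dvd (F ^^ j) 0 \<longleftrightarrow> p\<^sup>2 dvd j"
  proof (cases "p dvd j")
    case True
    define w where "w = a * c * (\<Sum>i<j. int i) + q * c\<^sup>2 * (\<Sum>i<j. (int i)\<^sup>2)"
    have "int p dvd a * (\<Sum>i<j. int i)"
      using a prime_dvd_sum_lessThan[OF p _ True] by (metis dvd_mult dvd_mult2)
    moreover have "int p dvd q * (\<Sum>i<j. (int i)\<^sup>2)"
      using q prime_dvd_sum_squares_lessThan[OF p _ True] by (metis dvd_mult dvd_mult2)
    ultimately have "int p dvd c * (a * (\<Sum>i<j. int i)) + c\<^sup>2 * (q * (\<Sum>i<j. (int i)\<^sup>2))" by simp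
    then have "int p dvd w" by (simp add: w_def algebra_simps)
    have "[(F ^^ j) 0 = c * int j + int p * w] (mod (int p)\<^sup>2)"
      unfolding w_def by (rule quadratic_iterate_expansion[OF F])
    also have "[c * int j + int p * w = c * int j] (mod (int p)\<^sup>2)"
      using \<open>int p dvd w\<close> by (simp add: cong_iff_dvd_diff power2_eq_square)
    finally have "[(F ^^ j) 0 = c * int j] (mod (int p)\<^sup>2)" .
    moreover have "coprime ((int p)\<^sup>2) c" using p c by (simp add: prime_imp_coprime)
    ultimately have "(int p)\<^sup>2 dvd (F ^^ j) 0 \<longleftrightarrow> (int p)\<^sup>2 dvd int j"
      by (simp add: cong_dvd_iff coprime_dvd_mult_right_iff)
    then show ?thesis by (metis int_dvd_int_iff of_nat_power)
  next
    case False
    then have "\<not> int p dvd (F ^^ j) 0" using period by (simp add: full_period_def)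
    moreover have "int p dvd int (p\<^sup>2)" "p dvd p\<^sup>2" by (simp_all add: power2_eq_square)
    ultimately show ?thesis using False by (metis dvd_trans)
  qed
qed

section \<open>Integer polynomials modulo prime powers\<close>

lemma diff_dvd_poly_diff:
  fixes P :: "'a :: comm_ring_1 poly"
  shows "x - y dvd poly P x - poly P y"
proof (induction P)
  case (pCons a P)
  have "poly (pCons a P) x - poly (pCons a P) y
      = (x - y) * poly P x + y * (poly P x - poly P y)"
    by (simp add: algebra_simps)
  then show ?case using pCons.IH by simp
qed simp

lemma cong_poly:
  fixes P :: "int poly"
  shows "[x = y] (mod m) \<Longrightarrow> [poly P x = poly P y] (mod m)"
  unfolding cong_iff_dvd_diff by (rule dvd_trans[OF _ diff_dvd_poly_diff])

lemma power2_dvd_poly_taylor: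
  fixes P :: "'a :: idom poly"
  shows "h\<^sup>2 dvd poly P (x + h) - (poly P x + h * poly (pderiv P) x)"
proof (induction P)
  case (pCons a P)
  have "poly (pCons a P) (x + h) - (poly (pCons a P) x + h * poly (pderiv (pCons a P)) x)
      = x * (poly P (x + h) - (poly P x + h * poly (pderiv P) x)) + h * (poly P (x + h) - poly P x)"
    by (simp add: pderiv_pCons algebra_simps)
  moreover have "h * h dvd h * (poly P (x + h) - poly P x)"
    using diff_dvd_poly_diff[of "x + h" x P] by (intro mult_dvd_mono) simp_all
  ultimately show ?case using pCons.IH by (simp add: power2_eq_square)
qed simp

definition inj_modulo :: "(int \<Rightarrow> int) \<Rightarrow> int \<Rightarrow> bool" where
  "inj_modulo F m \<longleftrightarrow> (\<forall>x y. [F x = F y] (mod m) \<longrightarrow> [x = y] (mod m))"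

lemma inj_modulo_iff_inj_on:
  fixes F :: "int \<Rightarrow> int"
  assumes "m > 0" and cong: "\<And>x y. [x = y] (mod m) \<Longrightarrow> [F x = F y] (mod m)"
  shows "inj_modulo F m \<longleftrightarrow> inj_on (\<lambda>r. F r mod m) {0..<m}"
proof
  assume inj: "inj_modulo F m"
  show "inj_on (\<lambda>r. F r mod m) {0..<m}"
  proof (rule inj_onI)
    fix x y assume xy: "x \<in> {0..<m}" "y \<in> {0..<m}" and "F x mod m = F y mod m"
    then have "x mod m = y mod m" using inj unfolding inj_modulo_def cong_def by blast
    then show "x = y" using xy by simp
  qed
next
  assume inj: "inj_on (\<lambda>r. F r mod m) {0..<m}"
  have F_mod: "F (x mod m) mod m = F x mod m" for x
    using cong[of "x mod m" x] by (simp add: cong_def)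
  show "inj_modulo F m"
    unfolding inj_modulo_def
  proof (intro allI impI)
    fix x y assume "[F x = F y] (mod m)"
    then have "F (x mod m) mod m = F (y mod m) mod m" by (simp add: F_mod cong_def)
    then have "x mod m = y mod m" using inj \<open>m > 0\<close> by (auto dest: inj_onD)
    then show "[x = y] (mod m)" by (simp add: cong_def)
  qed
qed

lemma inj_modulo_prime_square_imp_pderiv_nonzero:
  fixes P :: "int poly"
  assumes p: "prime p" and inj: "inj_modulo (poly P) (p\<^sup>2)"
  shows "\<not> p dvd poly (pderiv P) x"
proof
  assume "p dvd poly (pderiv P) x"
  then have "p\<^sup>2 dvd p * poly (pderiv P) x" by (simp add: power2_eq_square)
  then have "p\<^sup>2 dvd (poly P (x + p) - (poly P x + p * poly (pderiv P) x)) + p * poly (pderiv P) x"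
    by (intro dvd_add power2_dvd_poly_taylor)
  then have "[poly P (x + p) = poly P x] (mod p\<^sup>2)" by (simp add: cong_iff_dvd_diff)
  then have "[x + p = x] (mod p\<^sup>2)" using inj by (simp add: inj_modulo_def)
  then have "p * p dvd p * 1" by (simp add: cong_iff_dvd_diff power2_eq_square)
  then have "p dvd 1" using p by (subst (asm) dvd_mult_cancel_left) auto
  then show False using p not_prime_unit by blast
qed

lemma inj_modulo_prime_power_if_pderiv_nonzero:
  fixes P :: "int poly"
  assumes p: "prime p" and inj: "inj_modulo (poly P) p"
    and pderiv: "\<And>x. \<not> p dvd poly (pderiv P) x"
  shows "inj_modulo (poly P) (p ^ k)"
  unfolding inj_modulo_def
proof (intro allI impI)
  fix x y assume "[poly P x = poly P y] (mod p ^ k)"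
  then have dvd: "p ^ k dvd poly P x - poly P y" by (simp add: cong_iff_dvd_diff)
  show "[x = y] (mod p ^ k)"
  proof (cases "k = 0")
    case False
    then have "p dvd poly P x - poly P y" using dvd dvd_power dvd_trans by blast
    then have "p dvd x - y" using inj by (simp add: inj_modulo_def cong_iff_dvd_diff)
    obtain u where "poly P (y + (x - y)) - (poly P y + (x - y) * poly (pderiv P) y) = (x - y)\<^sup>2 * u"
      using power2_dvd_poly_taylor by blast
    then have "poly P x - poly P y = (x - y) * (poly (pderiv P) y + (x - y) * u)"
      by (simp add: algebra_simps power2_eq_square)
    moreover have "\<not> p dvd poly (pderiv P) y + (x - y) * u"
      using pderiv \<open>p dvd x - y\<close> by (simp add: dvd_add_left_iff)
    then have "coprime (p ^ k) (poly (pderiv P) y + (x - y) * u)"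
      using p by (simp add: prime_imp_coprime)
    ultimately show ?thesis
      using dvd by (simp add: cong_iff_dvd_diff coprime_dvd_mult_left_iff)
  qed simp
qed

primrec poly_iterate :: "'a :: comm_semiring_1 poly \<Rightarrow> nat \<Rightarrow> 'a poly" where
  "poly_iterate P 0 = [:0, 1:]"
| "poly_iterate P (Suc n) = P \<circ>\<^sub>p poly_iterate P n"

lemma poly_poly_iterate: "poly (poly_iterate P n) = poly P ^^ n"
  by (induction n) (auto simp: poly_pcompose)

lemma poly_iterate_add: "poly_iterate P (m + n) = poly_iterate P m \<circ>\<^sub>p poly_iterate P n"
  by (induction m) (simp_all add: pcompose_assoc pcompose_pCons)

text \<open>\<open>H'\<close> is constant modulo \<open>4\<close> on the even numbers, because \<open>H''\<close> takes even values.\<close>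

lemma pderiv_self_pcompose_cong_square:
  fixes H :: "int poly"
  assumes "even (poly H 0)"
  shows "[poly (pderiv (H \<circ>\<^sub>p H)) 0 = (poly (pderiv H) 0)\<^sup>2] (mod 4)"
proof -
  obtain s where s: "poly H 0 = 2 * s" using assms by blast
  obtain c a b R where "H = pCons c (pCons a (pCons b R))" by (metis pCons_cases)
  then have "poly (pderiv (pderiv H)) 0 = 2 * b" by (simp add: pderiv_pCons)
  then have "4 dvd 2 * s * poly (pderiv (pderiv H)) 0" by simp
  moreover have "4 dvd poly (pderiv H) (0 + 2 * s)
      - (poly (pderiv H) 0 + 2 * s * poly (pderiv (pderiv H)) 0)"
    by (rule dvd_trans[OF _ power2_dvd_poly_taylor]) (simp add: power_mult_distrib)
  ultimately have "4 dvd poly (pderiv H) (0 + 2 * s)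
      - (poly (pderiv H) 0 + 2 * s * poly (pderiv (pderiv H)) 0)
      + 2 * s * poly (pderiv (pderiv H)) 0"
    by (intro dvd_add)
  then have "[poly (pderiv H) (poly H 0) = poly (pderiv H) 0] (mod 4)"
    by (simp add: s cong_iff_dvd_diff)
  then have "[poly (pderiv H) (poly H 0) * poly (pderiv H) 0
      = poly (pderiv H) 0 * poly (pderiv H) 0] (mod 4)"
    by (intro cong_mult cong_refl)
  then show ?thesis by (simp add: pderiv_pcompose poly_pcompose power2_eq_square)
qed

lemma int_poly_rescale:
  fixes G :: "int poly"
  assumes "M \<noteq> 0" and "M dvd poly G 0"
  obtains S c b where "\<And>t. poly G (M * t) = M * S t"
    and "\<And>t. [S t = c + poly (pderiv G) 0 * t + M * b * t\<^sup>2] (mod M\<^sup>2)"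
proof -
  obtain c0 a b R where G: "G = pCons c0 (pCons a (pCons b R))" by (metis pCons_cases)
  then have a: "poly (pderiv G) 0 = a" by (simp add: pderiv_pCons)
  obtain c where c: "c0 = M * c" using assms(2) by (auto simp: G)
  define S where "S t = c + a * t + M * b * t\<^sup>2 + M\<^sup>2 * (t ^ 3 * poly R (M * t))" for t
  show thesis
  proof (rule that[of S c b])
    show "poly G (M * t) = M * S t" for t
      by (simp add: G c S_def algebra_simps power2_eq_square power3_eq_cube)
    show "[S t = c + poly (pderiv G) 0 * t + M * b * t\<^sup>2] (mod M\<^sup>2)" for t
      unfolding a S_def cong_def by (rule mod_mult_self2)
  qed
qed

lemma pderiv_poly_iterate_cong_1_mod_4:
  fixes P :: "int poly"
  assumes period: "full_period (poly P) 2" and "4 dvd n"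
    and odd: "odd (poly (pderiv (poly_iterate P n)) 0)"
  shows "[poly (pderiv (poly_iterate P n)) 0 = 1] (mod 4)"
proof -
  obtain k where n: "n = 2 * k + 2 * k" using \<open>4 dvd n\<close> by (auto elim!: dvdE)
  define H where "H = poly_iterate P (2 * k)"
  have "even (poly H 0)" using period by (simp add: H_def poly_poly_iterate full_period_def)
  then have square: "[poly (pderiv (poly_iterate P n)) 0 = (poly (pderiv H) 0)\<^sup>2] (mod 4)"
    unfolding n poly_iterate_add H_def[symmetric] by (rule pderiv_self_pcompose_cong_square)
  then have "odd (poly (pderiv H) 0)"
    using odd cong_dvd_modulus[of _ _ 4 2] cong_dvd_iff by fastforce
  then obtain e where "poly (pderiv H) 0 = 2 * e + 1" by (elim oddE)
  then have "(poly (pderiv H) 0)\<^sup>2 = 1 + 4 * (e\<^sup>2 + e)" by (simp add: power2_eq_square algebra_simps)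
  also have "[1 + 4 * (e\<^sup>2 + e) = 1] (mod 4)" unfolding cong_iff_dvd_diff by simp
  finally show ?thesis using square cong_trans by blast
qed

lemma full_period_rescaled_quadratic:
  fixes P :: "int poly"
  assumes p: "prime p" and "m > 0"
    and period: "full_period (poly P) (p * m)" "full_period (poly P) (p * m * p)"
  obtains S c a b where "\<And>k. full_period (poly P) (p * m * k) \<longleftrightarrow> full_period S k"
    and "\<And>t. [S t = t + c + int p * (a * t + (int m * b) * t\<^sup>2)] (mod (int p)\<^sup>2)"
    and "\<not> int p dvd c" and "poly (pderiv (poly_iterate P (p * m))) 0 = 1 + int p * a"
proof -
  define G where "G = poly_iterate P (p * m)"
  have G: "poly G = poly P ^^ (p * m)" by (simp add: G_def poly_poly_iterate)
  have "p * m > 0" using p \<open>m > 0\<close> by (simp add: prime_gt_0_nat)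
  have "int (p * m) dvd poly G 0" using period(1) by (simp add: full_period_def G)
  then obtain S c b where S: "\<And>t. poly G (int (p * m) * t) = int (p * m) * S t"
    and S_cong: "\<And>t. [S t = c + poly (pderiv G) 0 * t + int (p * m) * b * t\<^sup>2] (mod (int (p * m))\<^sup>2)"
    using \<open>p * m > 0\<close> int_poly_rescale[of "int (p * m)" G] by auto
  have rescale: "full_period (poly P) (p * m * k) \<longleftrightarrow> full_period S k" for k
    using \<open>p * m > 0\<close> period(1) S by (intro full_period_rescale) (simp_all add: G)
  then have period_S: "full_period S p" using period(2) by blast
  have "[S t = c + poly (pderiv G) 0 * t] (mod int p)" for t
  proof -
    have "[S t = c + poly (pderiv G) 0 * t + int (p * m) * b * t\<^sup>2] (mod int p)"
      by (rule cong_dvd_modulus[OF S_cong]) (simp add: power2_eq_square)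
    also have "[c + poly (pderiv G) 0 * t + int (p * m) * b * t\<^sup>2
        = c + poly (pderiv G) 0 * t] (mod int p)"
      by (simp add: cong_iff_dvd_diff)
    finally show ?thesis .
  qed
  from affine_full_period_mod_prime[OF p period_S this]
  have c: "\<not> int p dvd c" and slope: "[poly (pderiv G) 0 = 1] (mod int p)" by blast+
  then obtain a where a: "poly (pderiv G) 0 = 1 + int p * a"
    by (metis cong_iff_lin cong_sym mult.commute)
  have "[S t = t + c + int p * (a * t + (int m * b) * t\<^sup>2)] (mod (int p)\<^sup>2)" for t
    using cong_dvd_modulus[OF S_cong[of t], of "(int p)\<^sup>2"]
    by (simp add: a algebra_simps power_mult_distrib)
  then show thesis using rescale c a by (intro that[of S c a b]) (simp_all add: G_def)
qed

lemma full_period_mult_prime_square: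
  fixes P :: "int poly"
  assumes p: "prime p" and "m > 0" and m: "p \<le> 3 \<Longrightarrow> p dvd m"
    and period: "full_period (poly P) (p * m)" "full_period (poly P) (p * m * p)"
    and period_2: "p = 2 \<Longrightarrow> full_period (poly P) 2"
  shows "full_period (poly P) (p * m * p\<^sup>2)"
proof -
  obtain S c a b where rescale: "\<And>k. full_period (poly P) (p * m * k) \<longleftrightarrow> full_period S k"
    and S: "\<And>t. [S t = t + c + int p * (a * t + (int m * b) * t\<^sup>2)] (mod (int p)\<^sup>2)"
    and c: "\<not> int p dvd c" and slope: "poly (pderiv (poly_iterate P (p * m))) 0 = 1 + int p * a"
    using full_period_rescaled_quadratic[OF p \<open>m > 0\<close> period] by blast
  have period_S: "full_period S p" using period(2) rescale by blast
  have "int p dvd a" if "p = 2"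
  proof -
    have "4 dvd p * m" using m that by auto
    then have "[poly (pderiv (poly_iterate P (p * m))) 0 = 1] (mod 4)"
      using period_2 that slope by (intro pderiv_poly_iterate_cong_1_mod_4) auto
    then have "4 dvd 2 * a" using slope that by (simp add: cong_iff_dvd_diff)
    then have "even a" by presburger
    then show ?thesis using that by simp
  qed
  moreover have "p > 3 \<or> int p dvd int m * b" using m by (cases "p \<le> 3") auto
  ultimately have "full_period S (p\<^sup>2)"
    by (intro quadratic_full_period_prime_square[OF p period_S c S]) auto
  then show ?thesis using rescale by blast
qed

lemma full_period_prime_power:
  fixes P :: "int poly"
  assumes p: "prime p" and period: "\<And>j. j \<le> m \<Longrightarrow> full_period (poly P) (p ^ j)"
    and m: "m \<ge> 2" "p \<le> 3 \<Longrightarrow> m \<ge> 3"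
  shows "full_period (poly P) (p ^ k)"
proof (induction k rule: less_induct)
  case (less k)
  show ?case
  proof (cases "k \<le> m")
    case False
    define n where "n = k - 3"
    have k: "k = n + 3" using False m by (simp add: n_def)
    have "full_period (poly P) (p * p ^ n * p\<^sup>2)"
    proof (rule full_period_mult_prime_square[OF p])
      show "p ^ n > 0" using p by (simp add: prime_gt_0_nat)
      show "p dvd p ^ n" if "p \<le> 3" using m(2)[OF that] False k by simp
      show "full_period (poly P) (p * p ^ n)" "full_period (poly P) (p * p ^ n * p)"
        using less.IH[of "n + 1"] less.IH[of "n + 2"] k by (simp_all add: mult.commute)
      show "full_period (poly P) 2" if "p = 2" using period[of 1] m(1) that by simp
    qed
    then show ?thesis by (simp add: k power_add power2_eq_square power3_eq_cube ac_simps)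
  qed (rule period)
qed

section \<open>The class B modulo prime powers\<close>

lemma padic_int_of_coherent:
  assumes coherent: "\<And>k. [Y (Suc k) = Y k] (mod int CARD('p :: prime_card) ^ k)"
  obtains y :: "'p :: prime_card padic_int" where "\<And>k. padic_residue y k = Y k mod int CARD('p) ^ k"
proof -
  have "Y (Suc k) mod int CARD('p) ^ Suc k mod int CARD('p) ^ k = Y k mod int CARD('p) ^ k" for k
    using coherent[of k] by (simp add: mod_Suc_pow_mod cong_def)
  then show thesis
    by (intro that[of "Abs_padic_int (\<lambda>k. Y k mod int CARD('p) ^ k)"])
       (simp add: Abs_padic_int_inverse)
qed

lemma cong_mult_cancel_prime_power:
  fixes N p :: int
  assumes p: "prime p" and "N \<noteq> 0" and cong: "[N * x = N * y] (mod p ^ (k + multiplicity p N))"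
  shows "[x = y] (mod p ^ k)"
proof -
  obtain n where n: "N = p ^ multiplicity p N * n" "\<not> p dvd n"
    using multiplicity_decompose'[of N p] \<open>N \<noteq> 0\<close> p by (metis not_prime_unit)
  have "p ^ multiplicity p N * p ^ k dvd p ^ multiplicity p N * (n * (x - y))"
    using cong by (subst (asm) (1 2) n(1)) (simp add: cong_iff_dvd_diff power_add algebra_simps)
  then have "p ^ k dvd n * (x - y)" using p by (subst (asm) dvd_mult_cancel_left) auto
  moreover have "coprime (p ^ k) n" using p n(2) by (simp add: prime_imp_coprime)
  ultimately show ?thesis by (simp add: cong_iff_dvd_diff coprime_dvd_mult_right_iff)
qed

lemma of_int_dvd_padicI:
  fixes z :: "'p :: prime_card padic_int"
  assumes "N \<noteq> 0" and solvable: "\<And>k. \<exists>y. [N * y = padic_residue z k] (mod int CARD('p) ^ k)"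
  shows "of_int N dvd z"
proof -
  let ?p = "int CARD('p)"
  define v where "v = multiplicity ?p N"
  have "\<forall>k. \<exists>y. [N * y = padic_residue z (k + v)] (mod ?p ^ (k + v))" using solvable by blast
  from choice[OF this] obtain Y
    where Y: "\<And>k. [N * Y k = padic_residue z (k + v)] (mod ?p ^ (k + v))"
    by blast
  have z: "[padic_residue z j = padic_residue z k] (mod ?p ^ k)" if "k \<le> j" for j k
    using padic_residue_mod[OF that, of z] by (simp add: cong_def)
  have "[Y (Suc k) = Y k] (mod ?p ^ k)" for k
  proof (rule cong_mult_cancel_prime_power[OF prime_card_int \<open>N \<noteq> 0\<close>])
    have "[N * Y (Suc k) = padic_residue z (Suc k + v)] (mod ?p ^ (k + v))"
      by (rule cong_dvd_modulus[OF Y]) simp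
    also have "[padic_residue z (Suc k + v) = padic_residue z (k + v)] (mod ?p ^ (k + v))"
      by (rule z) simp
    also have "[padic_residue z (k + v) = N * Y k] (mod ?p ^ (k + v))" by (rule cong_sym[OF Y])
    finally show "[N * Y (Suc k) = N * Y k] (mod ?p ^ (k + multiplicity ?p N))" by (simp add: v_def)
  qed
  then obtain y :: "'p padic_int" where y: "\<And>k. padic_residue y k = Y k mod ?p ^ k"
    using padic_int_of_coherent[of Y] by blast
  have "padic_residue z k = padic_residue (of_int N * y) k" for k
  proof -
    have "[N * Y k = padic_residue z (k + v)] (mod ?p ^ k)"
      by (rule cong_dvd_modulus[OF Y]) (simp add: le_imp_power_dvd)
    also have "[padic_residue z (k + v) = padic_residue z k] (mod ?p ^ k)" by (rule z) simp
    finally show ?thesis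
      by (simp add: times_padic_int.rep_eq padic_residue_of_int y cong_def mod_simps)
  qed
  then have "z = of_int N * y" by (rule padic_eqI)
  then show ?thesis by simp
qed

lemma padic_residue_sum:
  "padic_residue (sum f A :: 'p :: prime_card padic_int) k
    = (\<Sum>i\<in>A. padic_residue (f i) k) mod int CARD('p) ^ k"
  by (induction A rule: infinite_finite_induct) (simp_all add: padic_residue_simps mod_simps)

lemma padic_residue_prod:
  "padic_residue (prod f A :: 'p :: prime_card padic_int) k
    = (\<Prod>i\<in>A. padic_residue (f i) k) mod int CARD('p) ^ k"
  by (induction A rule: infinite_finite_induct) (simp_all add: padic_residue_simps mod_simps)

lemma eventually_padic_residue_eq:
  fixes l :: "'p :: prime_card padic_int"
  assumes "(X \<longlongrightarrow> l) F"
  shows "\<forall>\<^sub>F n in F. padic_residue (X n) k = padic_residue l k"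
proof -
  have "1 / real CARD('p) ^ k > 0" using p_gt_1[where 'p = 'p] by simp
  with assms have "\<forall>\<^sub>F n in F. dist (X n) l < 1 / real CARD('p) ^ k" by (rule tendstoD)
  then show ?thesis by eventually_elim (simp flip: padic_dist_le_iff)
qed

lemma padic_residue_sums:
  fixes u :: "nat \<Rightarrow> 'p :: prime_card padic_int"
  assumes "u sums l" and vanish: "\<And>i. i \<ge> N \<Longrightarrow> padic_residue (u i) k = 0"
  shows "padic_residue l k = padic_residue (\<Sum>i<N. u i) k"
proof -
  have "\<forall>\<^sub>F n in sequentially. padic_residue (\<Sum>i<n. u i) k = padic_residue l k"
    using assms(1) unfolding sums_def by (rule eventually_padic_residue_eq)
  then obtain n where n: "n \<ge> N" "padic_residue (\<Sum>i<n. u i) k = padic_residue l k"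
    using eventually_ge_at_top[of N]
    by (metis (mono_tags, lifting) eventually_at_top_linorder linorder_le_cases)
  have "(\<Sum>i<n. padic_residue (u i) k) = (\<Sum>i<N. padic_residue (u i) k)"
    using n(1) vanish by (intro sum.mono_neutral_right) auto
  then show ?thesis using n(2) by (simp add: padic_residue_sum)
qed

definition ffact :: "nat \<Rightarrow> 'a :: comm_ring_1 \<Rightarrow> 'a" where
  "ffact i x = (\<Prod>j=0..<i. x - of_nat j)"

lemma fact_dvd_ffact_int: "fact i dvd ffact i (x :: int)"
  by (simp add: ffact_def falling_fact_pochhammer' fact_dvd_pochhammer)

lemma padic_residue_ffact:
  fixes x :: "'p :: prime_card padic_int"
  shows "padic_residue (ffact i x) k = ffact i (padic_residue x k) mod int CARD('p) ^ k"
proof -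
  have "[(\<Prod>j=0..<i. padic_residue (x - of_nat j) k) = ffact i (padic_residue x k)]
      (mod int CARD('p) ^ k)"
    unfolding ffact_def
    by (intro cong_prod) (simp add: padic_residue_simps padic_residue_of_nat mod_simps cong_def)
  then show ?thesis unfolding ffact_def padic_residue_prod cong_def .
qed

lemma fact_dvd_ffact_padic:
  fixes x :: "'p :: prime_card padic_int"
  shows "fact i dvd ffact i x"
proof -
  have "\<exists>y. [fact i * y = padic_residue (ffact i x) k] (mod int CARD('p) ^ k)" for k
  proof -
    obtain y where "ffact i (padic_residue x k) = fact i * y"
      using fact_dvd_ffact_int by (rule dvdE)
    then have "[fact i * y = padic_residue (ffact i x) k] (mod int CARD('p) ^ k)"
      by (simp add: padic_residue_ffact cong_def)
    then show ?thesis ..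
  qed
  then have "of_int (fact i) dvd ffact i x" by (intro of_int_dvd_padicI) simp_all
  then show ?thesis by simp
qed

lemma padic_residue_ffact_eq_0:
  fixes x :: "'p :: prime_card padic_int"
  assumes "i \<ge> CARD('p) ^ k"
  shows "padic_residue (ffact i x) k = 0"
proof -
  have "CARD('p) ^ k dvd fact i"
    using assms p_gt_1[where 'p = 'p] by (intro dvd_fact) simp_all
  then have "int CARD('p) ^ k dvd fact i" by (metis int_dvd_int_iff of_nat_fact of_nat_power)
  then have "int CARD('p) ^ k dvd ffact i (padic_residue x k)"
    using fact_dvd_ffact_int dvd_trans by blast
  then show ?thesis by (simp add: padic_residue_ffact)
qed

lemma padic_B_sums_ffact:
  fixes f :: "'p :: prime_card padic_int \<Rightarrow> 'p padic_int"
  assumes "f \<in> padic_B"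
  obtains b where "\<And>x. (\<lambda>i. b i * ffact i x) sums f x"
proof -
  obtain a where "\<forall>i. fact i dvd a i" and sums: "\<And>x. (\<lambda>i. a i * padic_binom x i) sums f x"
    using assms by (auto simp: padic_B_def)
  then obtain b where b: "a i = fact i * b i" for i unfolding dvd_def by metis
  have "a i * padic_binom x i = b i * ffact i x" for i x
    using fact_dvd_ffact_padic[of i x] by (simp add: b padic_binom_def ffact_def ac_simps)
  then show thesis using sums by (intro that[of b]) simp
qed

lemma padic_B_induces_poly:
  fixes f :: "'p :: prime_card padic_int \<Rightarrow> 'p padic_int"
  assumes "f \<in> padic_B"
  obtains P where "induces_mod f k (\<lambda>r. poly P r mod int CARD('p) ^ k)"
proof -
  obtain b where b: "\<And>x. (\<lambda>i. b i * ffact i x) sums f x" using padic_B_sums_ffact[OF assms] by blast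
  define P where
    "P = (\<Sum>i<CARD('p) ^ k. Polynomial.smult (padic_residue (b i) k) (\<Prod>j=0..<i. [:- int j, 1:]))"
  have "padic_residue (f x) k = poly P (padic_residue x k) mod int CARD('p) ^ k" for x
  proof -
    have "padic_residue (f x) k = padic_residue (\<Sum>i<CARD('p) ^ k. b i * ffact i x) k"
      using b
      by (rule padic_residue_sums) (simp add: times_padic_int.rep_eq padic_residue_ffact_eq_0)
    also have "\<dots> = (\<Sum>i<CARD('p) ^ k. padic_residue (b i) k * ffact i (padic_residue x k))
        mod int CARD('p) ^ k"
      by (simp add: padic_residue_sum times_padic_int.rep_eq padic_residue_ffact
          mod_sum_eq mod_mult_right_eq)
    also have "(\<Sum>i<CARD('p) ^ k. padic_residue (b i) k * ffact i (padic_residue x k))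
        = poly P (padic_residue x k)"
      by (simp add: P_def poly_sum poly_prod ffact_def)
    finally show ?thesis .
  qed
  then show thesis by (intro that[of P]) (simp add: induces_mod_def)
qed

section \<open>Maps induced on residues\<close>

lemma range_padic_residue:
  "range (\<lambda>x :: 'p :: prime_card padic_int. padic_residue x k) = {0..<int CARD('p) ^ k}"
proof
  show "{0..<int CARD('p) ^ k} \<subseteq> range (\<lambda>x :: 'p padic_int. padic_residue x k)"
  proof
    fix r assume "r \<in> {0..<int CARD('p) ^ k}"
    then have "r = padic_residue (of_int r :: 'p padic_int) k" by (simp add: padic_residue_of_int)
    then show "r \<in> range (\<lambda>x :: 'p padic_int. padic_residue x k)" by (rule range_eqI)
  qed
qed (use padic_residue_bounds in auto)

lemma lipschitz_induces_mod:
  fixes f :: "'p :: prime_card padic_int \<Rightarrow> 'p padic_int"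
  assumes "1-lipschitz_on UNIV f"
  obtains g where "induces_mod f k g"
proof
  show "induces_mod f k (\<lambda>r. padic_residue (f (of_int r)) k)"
    unfolding induces_mod_def
  proof
    fix x :: "'p padic_int"
    have "padic_residue x k = padic_residue (of_int (padic_residue x k) :: 'p padic_int) k"
      by (simp add: padic_residue_of_int)
    then have "dist x (of_int (padic_residue x k)) \<le> 1 / real CARD('p) ^ k"
      by (simp only: padic_dist_le_iff)
    then have "dist (f x) (f (of_int (padic_residue x k))) \<le> 1 / real CARD('p) ^ k"
      using lipschitz_onD[OF assms UNIV_I UNIV_I, of x "of_int (padic_residue x k)"] by simp
    then show "padic_residue (f x) k = padic_residue (f (of_int (padic_residue x k))) k"
      by (simp only: padic_dist_le_iff)
  qed
qed

lemma induces_mod_unique: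
  fixes f :: "'p :: prime_card padic_int \<Rightarrow> 'p padic_int"
  assumes "induces_mod f k g" "induces_mod f k h" "r \<in> {0..<int CARD('p) ^ k}"
  shows "g r = h r"
proof -
  obtain x :: "'p padic_int" where "r = padic_residue x k"
    using assms(3) unfolding range_padic_residue[symmetric] by blast
  then show ?thesis using assms(1,2) by (metis induces_mod_def)
qed

lemma induces_mod_image:
  fixes f :: "'p :: prime_card padic_int \<Rightarrow> 'p padic_int"
  assumes "induces_mod f k g"
  shows "g ` {0..<int CARD('p) ^ k} = range (\<lambda>x. padic_residue (f x) k)"
proof -
  have "padic_residue (f x) k = g (padic_residue x k)" for x
    using assms by (simp add: induces_mod_def)
  then show ?thesis unfolding range_padic_residue[symmetric] image_image by simp
qed

lemma induces_mod_funpow: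
  assumes "induces_mod f k g"
  shows "induces_mod (f ^^ i) k (g ^^ i)"
  by (induction i) (use assms in \<open>simp_all add: induces_mod_def\<close>)

lemma bijective_mod_iff_bij_betw:
  fixes f :: "'p :: prime_card padic_int \<Rightarrow> 'p padic_int"
  assumes "induces_mod f k g"
  shows "bijective_mod f k \<longleftrightarrow> bij_betw g {0..<int CARD('p) ^ k} {0..<int CARD('p) ^ k}"
proof
  assume "bijective_mod f k"
  then obtain h where h: "induces_mod f k h"
    "bij_betw h {0..<int CARD('p) ^ k} {0..<int CARD('p) ^ k}"
    by (auto simp: bijective_mod_def)
  with induces_mod_unique[OF h(1) assms]
  show "bij_betw g {0..<int CARD('p) ^ k} {0..<int CARD('p) ^ k}"
    using bij_betw_cong[of "{0..<int CARD('p) ^ k}" h g] by blast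
qed (use assms in \<open>auto simp: bijective_mod_def\<close>)

lemma bijective_mod_iff_surj:
  fixes f :: "'p :: prime_card padic_int \<Rightarrow> 'p padic_int"
  assumes "induces_mod f k g"
  shows "bijective_mod f k \<longleftrightarrow> (\<forall>y :: 'p padic_int. \<exists>x. padic_residue (f x) k = padic_residue y k)"
proof -
  have "bijective_mod f k \<longleftrightarrow> g ` {0..<int CARD('p) ^ k} = {0..<int CARD('p) ^ k}"
    unfolding bijective_mod_iff_bij_betw[OF assms] bij_betw_def
    by (auto intro: eq_card_imp_inj_on)
  also have "\<dots> \<longleftrightarrow> range (\<lambda>x. padic_residue (f x) k) = range (\<lambda>y :: 'p padic_int. padic_residue y k)"
    by (simp only: induces_mod_image[OF assms] range_padic_residue)
  also have "\<dots> \<longleftrightarrow> range (\<lambda>y :: 'p padic_int. padic_residue y k) \<subseteq> range (\<lambda>x. padic_residue (f x) k)"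
    by auto
  also have "\<dots> \<longleftrightarrow> (\<forall>y :: 'p padic_int. \<exists>x. padic_residue (f x) k = padic_residue y k)"
    by (simp add: image_subset_iff image_iff eq_commute)
  finally show ?thesis .
qed

lemma bijective_mod_iff_inj_on:
  fixes f :: "'p :: prime_card padic_int \<Rightarrow> 'p padic_int"
  assumes "induces_mod f k g"
  shows "bijective_mod f k \<longleftrightarrow> inj_on g {0..<int CARD('p) ^ k}"
proof -
  have "g ` {0..<int CARD('p) ^ k} \<subseteq> {0..<int CARD('p) ^ k}"
    using padic_residue_bounds by (auto simp: induces_mod_image[OF assms])
  then show ?thesis
    unfolding bijective_mod_iff_bij_betw[OF assms] bij_betw_def using endo_inj_surj[of _ g] by blast
qed

lemma bijective_mod_mono:
  fixes f :: "'p :: prime_card padic_int \<Rightarrow> 'p padic_int"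
  assumes "bijective_mod f k" "j \<le> k" "induces_mod f j g"
  shows "bijective_mod f j"
proof -
  obtain h where "induces_mod f k h" using assms(1) by (auto simp: bijective_mod_def)
  then have "\<forall>y :: 'p padic_int. \<exists>x. padic_residue (f x) k = padic_residue y k"
    using assms(1) bijective_mod_iff_surj by blast
  then have "\<forall>y :: 'p padic_int. \<exists>x. padic_residue (f x) j = padic_residue y j"
    by (metis padic_residue_mod[OF assms(2)])
  then show ?thesis using assms(3) bijective_mod_iff_surj by blast
qed

lemma transitive_mod_iff_cyclic_on:
  fixes f :: "'p :: prime_card padic_int \<Rightarrow> 'p padic_int"
  assumes "induces_mod f k g"
  shows "transitive_mod f k \<longleftrightarrow> cyclic_on g {0..<int CARD('p) ^ k}"
proof
  assume "transitive_mod f k"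
  then obtain h where h: "induces_mod f k h" "cyclic_on h {0..<int CARD('p) ^ k}"
    by (auto simp: transitive_mod_def)
  with induces_mod_unique[OF h(1) assms] show "cyclic_on g {0..<int CARD('p) ^ k}"
    using cyclic_cong[of "{0..<int CARD('p) ^ k}" h g] by blast
next
  assume cyclic: "cyclic_on g {0..<int CARD('p) ^ k}"
  then have "g ` {0..<int CARD('p) ^ k} = {0..<int CARD('p) ^ k}" by (rule cyclic_on_image_eq)
  then have "bij_betw g {0..<int CARD('p) ^ k} {0..<int CARD('p) ^ k}"
    by (simp add: bij_betw_def eq_card_imp_inj_on)
  then show "transitive_mod f k" using assms cyclic by (auto simp: transitive_mod_def)
qed

lemma transitive_mod_imp_bijective_mod: "transitive_mod f k \<Longrightarrow> bijective_mod f k"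
  by (auto simp: transitive_mod_def bijective_mod_def)

lemma transitive_mod_iff_orbit:
  fixes f :: "'p :: prime_card padic_int \<Rightarrow> 'p padic_int"
  assumes "induces_mod f k g"
  shows "transitive_mod f k
    \<longleftrightarrow> (\<forall>y :: 'p padic_int. \<exists>i>0. padic_residue ((f ^^ i) 0) k = padic_residue y k)"
proof -
  have iterate: "(g ^^ i) 0 = padic_residue ((f ^^ i) 0) k" for i
    using induces_mod_funpow[OF assms, of i] by (simp add: induces_mod_def padic_residue_simps)
  have "0 \<in> {0..<int CARD('p) ^ k}" by simp
  then have "transitive_mod f k \<longleftrightarrow> orbit g 0 = {0..<int CARD('p) ^ k}"
    unfolding transitive_mod_iff_cyclic_on[OF assms]
    using orbit_cyclic_eq3 cyclic_on_singleI by metis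
  also have "orbit g 0 = {padic_residue ((f ^^ i) 0) k | i. i > 0}"
    by (simp add: orbit_altdef iterate)
  also have "\<dots> = {0..<int CARD('p) ^ k}
      \<longleftrightarrow> range (\<lambda>y :: 'p padic_int. padic_residue y k) \<subseteq> {padic_residue ((f ^^ i) 0) k | i. i > 0}"
    unfolding range_padic_residue[symmetric] by auto
  also have "\<dots> \<longleftrightarrow> (\<forall>y :: 'p padic_int. \<exists>i>0. padic_residue ((f ^^ i) 0) k = padic_residue y k)"
    by (simp add: image_subset_iff eq_commute conj_commute)
  finally show ?thesis .
qed

lemma transitive_mod_mono:
  fixes f :: "'p :: prime_card padic_int \<Rightarrow> 'p padic_int"
  assumes "transitive_mod f k" "j \<le> k" "induces_mod f j g"
  shows "transitive_mod f j"
proof -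
  obtain h where "induces_mod f k h" using assms(1) by (auto simp: transitive_mod_def)
  then have "\<forall>y :: 'p padic_int. \<exists>i>0. padic_residue ((f ^^ i) 0) k = padic_residue y k"
    using assms(1) transitive_mod_iff_orbit by blast
  then have "\<forall>y :: 'p padic_int. \<exists>i>0. padic_residue ((f ^^ i) 0) j = padic_residue y j"
    by (metis padic_residue_mod[OF assms(2)])
  then show ?thesis using assms(3) transitive_mod_iff_orbit by blast
qed

lemma bijective_mod_iff_inj_modulo:
  fixes f :: "'p :: prime_card padic_int \<Rightarrow> 'p padic_int"
  assumes "induces_mod f k (\<lambda>r. poly P r mod int CARD('p) ^ k)"
  shows "bijective_mod f k \<longleftrightarrow> inj_modulo (poly P) (int CARD('p) ^ k)"
proof -
  have "bijective_mod f k
      \<longleftrightarrow> inj_on (\<lambda>r. poly P r mod int CARD('p) ^ k) {0..<int CARD('p) ^ k}"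
    using assms by (rule bijective_mod_iff_inj_on)
  also have "\<dots> \<longleftrightarrow> inj_modulo (poly P) (int CARD('p) ^ k)"
    by (intro inj_modulo_iff_inj_on[symmetric] cong_poly) simp_all
  finally show ?thesis .
qed

lemma transitive_mod_iff_full_period:
  fixes f :: "'p :: prime_card padic_int \<Rightarrow> 'p padic_int"
  assumes "induces_mod f k (\<lambda>r. poly P r mod int CARD('p) ^ k)"
  shows "transitive_mod f k \<longleftrightarrow> full_period (poly P) (CARD('p) ^ k)"
proof -
  have "transitive_mod f k
      \<longleftrightarrow> cyclic_on (\<lambda>r. poly P r mod int (CARD('p) ^ k)) {0..<int (CARD('p) ^ k)}"
    by (simp add: transitive_mod_iff_cyclic_on[OF assms])
  also have "\<dots> \<longleftrightarrow> full_period (poly P) (CARD('p) ^ k)"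
    by (intro cyclic_on_mod_iff_full_period cong_poly) simp_all
  finally show ?thesis .
qed

section \<open>Haar measure\<close>

lemma sets_padic_haar [simp, measurable_cong]:
  "sets (padic_haar :: 'p :: prime_card padic_int measure) = sets borel"
  using normalized_haar_padic_haar[where 'a = 'p] by (simp add: normalized_haar_def)

lemma space_padic_haar [simp]: "space (padic_haar :: 'p :: prime_card padic_int measure) = UNIV"
  using sets_eq_imp_space_eq[OF sets_padic_haar[where 'p = 'p]] by simp

lemma prob_space_padic_haar: "prob_space (padic_haar :: 'p :: prime_card padic_int measure)"
  using normalized_haar_padic_haar[where 'a = 'p]
  by (intro prob_spaceI) (simp add: normalized_haar_def)

lemma measure_padic_cyl:
  assumes "r \<in> {0..<int CARD('p :: prime_card) ^ k}"
  shows "measure padic_haar (padic_cyl k r :: 'p padic_int set) = 1 / real (CARD('p) ^ k)"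
proof -
  have "emeasure padic_haar (padic_cyl k r :: 'p padic_int set) = ennreal (1 / real (CARD('p) ^ k))"
    using haar_cyl[OF normalized_haar_padic_haar assms] p_gt_1[where 'p = 'p]
    by (simp add: divide_ennreal[symmetric] ennreal_of_nat_eq_real_of_nat)
  then show ?thesis by (simp add: measure_def)
qed

lemma measure_eq_sum_padic_cyl:
  fixes U :: "'p :: prime_card padic_int set"
  assumes "U \<in> sets borel"
  shows "measure padic_haar U = (\<Sum>r\<in>{0..<int CARD('p) ^ k}. measure padic_haar (U \<inter> padic_cyl k r))"
proof -
  interpret prob_space "padic_haar :: 'p padic_int measure" by (rule prob_space_padic_haar)
  have "U = (\<Union>r\<in>{0..<int CARD('p) ^ k}. U \<inter> padic_cyl k r)"
    using padic_residue_bounds[where 'p = 'p] by (auto simp: padic_cyl_def)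
  then have "prob U = prob (\<Union>r\<in>{0..<int CARD('p) ^ k}. U \<inter> padic_cyl k r)" by simp
  also have "\<dots> = (\<Sum>r\<in>{0..<int CARD('p) ^ k}. prob (U \<inter> padic_cyl k r))"
  proof (rule finite_measure_finite_Union)
    show "disjoint_family_on (\<lambda>r. U \<inter> padic_cyl k r) {0..<int CARD('p) ^ k}"
      by (auto simp: disjoint_family_on_def padic_cyl_def)
  qed (use assms in auto)
  finally show ?thesis .
qed

lemma vimage_padic_residue_borel:
  "{x :: 'p :: prime_card padic_int. padic_residue x k \<in> T} \<in> sets borel"
  by (intro borel_open padic_open_iff[THEN iffD2] ballI exI[of _ k]) (auto simp: padic_cyl_def)

lemma measure_vimage_padic_residue:
  assumes "T \<subseteq> {0..<int CARD('p :: prime_card) ^ k}"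
  shows "measure padic_haar {x :: 'p padic_int. padic_residue x k \<in> T}
    = card T / real (CARD('p) ^ k)"
proof -
  let ?U = "{x :: 'p padic_int. padic_residue x k \<in> T}"
  have "measure padic_haar ?U
      = (\<Sum>r\<in>{0..<int CARD('p) ^ k}. measure padic_haar (?U \<inter> padic_cyl k r))"
    by (intro measure_eq_sum_padic_cyl vimage_padic_residue_borel)
  also have "\<dots> = (\<Sum>r\<in>T. 1 / real (CARD('p) ^ k))"
  proof (intro sum.mono_neutral_cong_right)
    have "?U \<inter> padic_cyl k r = (if r \<in> T then padic_cyl k r else {})" for r
      by (auto simp: padic_cyl_def)
    then show "\<forall>r\<in>{0..<int CARD('p) ^ k} - T. measure padic_haar (?U \<inter> padic_cyl k r) = 0"
      and "\<And>r. r \<in> T \<Longrightarrow> measure padic_haar (?U \<inter> padic_cyl k r) = 1 / real (CARD('p) ^ k)"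
      using assms by (auto simp: measure_padic_cyl subset_iff)
  qed (use assms in auto)
  finally show ?thesis by simp
qed

lemma vimage_padic_cyl:
  fixes f :: "'p :: prime_card padic_int \<Rightarrow> 'p padic_int"
  assumes "induces_mod f k g" "inj_on g {0..<int CARD('p) ^ k}" "s \<in> {0..<int CARD('p) ^ k}"
  shows "f -` padic_cyl k (g s) = padic_cyl k s"
proof -
  have "g (padic_residue x k) = g s \<longleftrightarrow> padic_residue x k = s" for x :: "'p padic_int"
    using assms padic_residue_bounds[of x k] by (intro inj_on_eq_iff) auto
  then show ?thesis using assms(1) by (auto simp: padic_cyl_def induces_mod_def)
qed

lemma measure_preserving_imp_bijective_mod:
  fixes f :: "'p :: prime_card padic_int \<Rightarrow> 'p padic_int"
  assumes f: "measure_preserving f" and g: "induces_mod f k g"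
  shows "bijective_mod f k"
  unfolding bijective_mod_iff_surj[OF g]
proof
  fix y :: "'p padic_int"
  have "measure padic_haar (f -` padic_cyl k (padic_residue y k)) = 1 / real (CARD('p) ^ k)"
    using f measure_padic_cyl[of "padic_residue y k" k] padic_residue_bounds[of y k]
    by (simp add: measure_preserving_def)
  then have "f -` padic_cyl k (padic_residue y k) \<noteq> {}" by auto
  then show "\<exists>x. padic_residue (f x) k = padic_residue y k" by (auto simp: padic_cyl_def)
qed

lemma measure_preserving_if_bijective_mod:
  fixes f :: "'p :: prime_card padic_int \<Rightarrow> 'p padic_int"
  assumes lipschitz: "1-lipschitz_on UNIV f" and bij: "\<And>k. bijective_mod f k"
  shows "measure_preserving f"
proof -
  have "f \<in> borel_measurable borel"
    using lipschitz by (intro borel_measurable_continuous_onI lipschitz_on_continuous_on)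
  then have f: "f \<in> measurable padic_haar padic_haar" by (simp cong: measurable_cong_sets)
  have "distr padic_haar padic_haar f = padic_haar"
  proof (rule padic_measure_eqI)
    show "emeasure (distr padic_haar padic_haar f) UNIV \<noteq> \<infinity>"
      using f prob_space.emeasure_space_1[OF prob_space_padic_haar[where 'p = 'p]]
      by (simp add: emeasure_distr)
    fix k r assume r: "r \<in> {0..<int CARD('p) ^ k}"
    obtain g where g: "induces_mod f k g" "bij_betw g {0..<int CARD('p) ^ k} {0..<int CARD('p) ^ k}"
      using bij by (auto simp: bijective_mod_def)
    obtain s where s: "s \<in> {0..<int CARD('p) ^ k}" "r = g s"
      using r bij_betw_imp_surj_on[OF g(2)] by blast
    have "f -` padic_cyl k r = padic_cyl k s"
      using vimage_padic_cyl[OF g(1) bij_betw_imp_inj_on[OF g(2)] s(1)] s(2) by simp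
    then show "emeasure (distr padic_haar padic_haar f) (padic_cyl k r)
        = emeasure padic_haar (padic_cyl k r :: 'p padic_int set)"
      using f r s(1) by (simp add: emeasure_distr haar_cyl[OF normalized_haar_padic_haar])
  qed simp_all
  then have "measure padic_haar (f -` U) = measure padic_haar U" if "U \<in> sets padic_haar" for U
    using measure_distr[OF f that] by simp
  then show ?thesis using f by (simp add: measure_preserving_def)
qed

lemma measure_preserving_iff_bijective_mod:
  assumes "1-lipschitz_on UNIV f"
  shows "measure_preserving f \<longleftrightarrow> (\<forall>k. bijective_mod f k)"
proof
  assume "measure_preserving f"
  then show "\<forall>k. bijective_mod f k"
    using measure_preserving_imp_bijective_mod lipschitz_induces_mod[OF assms] by metis
qed (use measure_preserving_if_bijective_mod[OF assms] in blast)

lemma ergodic_imp_transitive_mod: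
  fixes f :: "'p :: prime_card padic_int \<Rightarrow> 'p padic_int"
  assumes f: "ergodic f" and g: "induces_mod f k g"
  shows "transitive_mod f k"
proof -
  define S where "S = {0..<int CARD('p) ^ k}"
  have S: "finite S" "card S = CARD('p) ^ k" "0 \<in> S" by (simp_all add: S_def nat_power_eq)
  have residue: "padic_residue x k \<in> S" for x :: "'p padic_int"
    using padic_residue_bounds[of x k] by (simp add: S_def)
  have "bijective_mod f k"
    using f g by (intro measure_preserving_imp_bijective_mod) (simp_all add: ergodic_def)
  then have bij: "bij_betw g S S" using g by (simp add: S_def bijective_mod_iff_bij_betw)
  define T where "T = orbit g 0"
  have "r \<in> S" if "r \<in> T" for r
    using that unfolding T_def by induction (use bij_betwE[OF bij] \<open>0 \<in> S\<close> in blast)+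
  then have T: "T \<subseteq> S" "g ` T \<subseteq> T" by (auto simp: T_def intro: orbit.step)
  define U where "U = {x :: 'p padic_int. padic_residue x k \<in> T}"
  have "f -` U = U"
    using g bij_betw_in_invariant_subset_iff[OF bij S(1) T residue]
    by (auto simp: U_def induces_mod_def)
  moreover have "U \<in> sets padic_haar" using vimage_padic_residue_borel by (simp add: U_def)
  ultimately have "measure padic_haar U \<in> {0, 1}" using f by (simp add: ergodic_def)
  moreover have "measure padic_haar U = card T / card S"
    using measure_vimage_padic_residue T(1) by (simp add: U_def S_def nat_power_eq)
  moreover have "card T > 0" "card S > 0"
    using T(1) S finite_subset[OF T(1)] by (auto simp: card_gt_0_iff T_def orbit_nonempty)
  ultimately have "card T = card S" by auto
  then have "T = S" using T(1) S(1) by (simp add: card_subset_eq)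
  then have "cyclic_on g S" using S(3) by (auto simp: T_def intro: cyclic_on_singleI)
  then show ?thesis using g by (simp add: S_def transitive_mod_iff_cyclic_on)
qed

lemma measure_invariant_Int_padic_cyl:
  fixes f :: "'p :: prime_card padic_int \<Rightarrow> 'p padic_int"
  assumes f: "measure_preserving f" and "transitive_mod f k"
    and U: "U \<in> sets borel" "f -` U = U" and r: "r \<in> {0..<int CARD('p) ^ k}"
  shows "measure padic_haar (U \<inter> padic_cyl k r)
    = measure padic_haar U * measure padic_haar (padic_cyl k r :: 'p padic_int set)"
proof -
  define S where "S = {0..<int CARD('p) ^ k}"
  obtain g where g: "induces_mod f k g" "bij_betw g S S" "cyclic_on g S"
    using assms(2) by (auto simp: transitive_mod_def S_def)
  have step: "measure padic_haar (U \<inter> padic_cyl k (g s)) = measure padic_haar (U \<inter> padic_cyl k s)"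
    if "s \<in> S" for s
  proof -
    have "f -` (U \<inter> padic_cyl k (g s)) = U \<inter> padic_cyl k s"
      using vimage_padic_cyl[OF g(1)] that bij_betw_imp_inj_on[OF g(2)] U(2)
      by (simp add: vimage_Int S_def)
    moreover have "U \<inter> padic_cyl k (g s) \<in> sets padic_haar" using U(1) by simp
    ultimately show ?thesis using f by (metis measure_preserving_def)
  qed
  have orbit: "orbit g r = S" using orbit_cyclic_eq3[OF g(3)] r by (simp add: S_def)
  have const: "measure padic_haar (U \<inter> padic_cyl k s) = measure padic_haar (U \<inter> padic_cyl k r)"
    if "s \<in> orbit g r" for s
    using that by induction (use step orbit r in \<open>simp_all add: S_def\<close>)
  have "measure padic_haar U = (\<Sum>s\<in>S. measure padic_haar (U \<inter> padic_cyl k s))"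
    unfolding S_def using U(1) by (rule measure_eq_sum_padic_cyl)
  also have "\<dots> = (\<Sum>s\<in>S. measure padic_haar (U \<inter> padic_cyl k r))"
    by (intro sum.cong refl const) (simp add: orbit)
  also have "\<dots> = real (CARD('p) ^ k) * measure padic_haar (U \<inter> padic_cyl k r)"
    by (simp add: S_def nat_power_eq)
  finally show ?thesis using p_gt_1[where 'p = 'p] by (simp add: measure_padic_cyl[OF r])
qed

lemma measure_zero_one_if_indep_padic_cyl:
  fixes U :: "'p :: prime_card padic_int set"
  assumes U: "U \<in> sets borel"
    and indep: "\<And>k r. r \<in> {0..<int CARD('p) ^ k} \<Longrightarrow>
      measure padic_haar (U \<inter> padic_cyl k r)
        = measure padic_haar U * measure padic_haar (padic_cyl k r :: 'p padic_int set)"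
  shows "measure padic_haar U \<in> {0, 1}"
proof -
  interpret prob_space "padic_haar :: 'p padic_int measure" by (rule prob_space_padic_haar)
  have "indep_set {U} padic_cyls"
  proof (rule indep_setI)
    fix a b assume "a \<in> {U}" "b \<in> (padic_cyls :: 'p padic_int set set)"
    then obtain k r where ab: "a = U" "b = padic_cyl k r" by auto
    show "prob (a \<inter> b) = prob a * prob b"
    proof (cases "r \<in> {0..<int CARD('p) ^ k}")
      case True
      then show ?thesis unfolding ab by (rule indep)
    next
      case False
      then show ?thesis by (simp add: ab padic_cyl_out)
    qed
  qed (use U in auto)
  then have "indep_set (sigma_sets UNIV {U}) (sets borel)"
    using indep_set_sigma_sets[of "{U}" padic_cyls] Int_stable_padic_cyls
    by (simp add: Int_stable_def sets_borel_padic)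
  from indep_setD[OF this, of U U] have "prob (U \<inter> U) = prob U * prob U" using U by simp
  then show ?thesis by simp
qed

lemma ergodic_if_transitive_mod:
  fixes f :: "'p :: prime_card padic_int \<Rightarrow> 'p padic_int"
  assumes lipschitz: "1-lipschitz_on UNIV f" and transitive: "\<And>k. transitive_mod f k"
  shows "ergodic f"
  unfolding ergodic_def
proof (intro conjI ballI impI)
  show "measure_preserving f"
    using lipschitz transitive_mod_imp_bijective_mod[OF transitive]
    by (rule measure_preserving_if_bijective_mod)
  fix U assume "U \<in> sets (padic_haar :: 'p padic_int measure)" "f -` U = U"
  then show "measure padic_haar U \<in> {0, 1}"
    using measure_invariant_Int_padic_cyl[OF \<open>measure_preserving f\<close> transitive]
    by (intro measure_zero_one_if_indep_padic_cyl) simp_all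
qed

lemma ergodic_iff_transitive_mod:
  assumes "1-lipschitz_on UNIV f"
  shows "ergodic f \<longleftrightarrow> (\<forall>k. transitive_mod f k)"
proof
  assume "ergodic f"
  then show "\<forall>k. transitive_mod f k"
    using ergodic_imp_transitive_mod lipschitz_induces_mod[OF assms] by metis
qed (use ergodic_if_transitive_mod[OF assms] in blast)

section \<open>The criterion\<close>

lemma induces_mod_poly_le:
  fixes f :: "'p :: prime_card padic_int \<Rightarrow> 'p padic_int"
  assumes f: "induces_mod f k (\<lambda>r. poly P r mod int CARD('p) ^ k)" and "j \<le> k"
  shows "induces_mod f j (\<lambda>r. poly P r mod int CARD('p) ^ j)"
  unfolding induces_mod_def
proof
  fix x :: "'p padic_int"
  have "padic_residue (f x) j
      = poly P (padic_residue x k) mod int CARD('p) ^ k mod int CARD('p) ^ j"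
    using f padic_residue_mod[OF \<open>j \<le> k\<close>, of "f x"] by (simp add: induces_mod_def)
  also have "\<dots> = poly P (padic_residue x k) mod int CARD('p) ^ j"
    using \<open>j \<le> k\<close> by (intro mod_mod_cancel le_imp_power_dvd)
  also have "\<dots> = poly P (padic_residue x j) mod int CARD('p) ^ j"
    using cong_poly[of "padic_residue x k" "padic_residue x j" "int CARD('p) ^ j" P]
      padic_residue_mod[OF \<open>j \<le> k\<close>, of x] by (simp add: cong_def)
  finally show "padic_residue (f x) j = poly P (padic_residue x j) mod int CARD('p) ^ j" .
qed

lemma padic_B_induces_poly_le:
  fixes f :: "'p :: prime_card padic_int \<Rightarrow> 'p padic_int"
  assumes "f \<in> padic_B"
  obtains P where "\<And>j. j \<le> k \<Longrightarrow> induces_mod f j (\<lambda>r. poly P r mod int CARD('p) ^ j)"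
proof -
  obtain P where "induces_mod f k (\<lambda>r. poly P r mod int CARD('p) ^ k)"
    using assms by (rule padic_B_induces_poly)
  then show thesis by (intro that[of P]) (rule induces_mod_poly_le)
qed

lemma padic_B_lipschitz:
  fixes f :: "'p :: prime_card padic_int \<Rightarrow> 'p padic_int"
  assumes "f \<in> padic_B"
  shows "1-lipschitz_on UNIV f"
proof (rule lipschitz_onI)
  fix x y :: "'p padic_int"
  show "dist (f x) (f y) \<le> 1 * dist x y"
  proof (cases "x - y" rule: padic_norm_cases)
    case (2 k)
    obtain P where "induces_mod f k (\<lambda>r. poly P r mod int CARD('p) ^ k)"
      using padic_B_induces_poly[OF assms, of k] by blast
    moreover have "padic_residue x k = padic_residue y k"
      using 2(1) by (simp add: dist_padic_int_def flip: padic_dist_le_iff)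
    ultimately have "dist (f x) (f y) \<le> 1 / real CARD('p) ^ k"
      by (simp add: padic_dist_le_iff induces_mod_def)
    then show ?thesis using 2(1) by (simp add: dist_padic_int_def)
  qed simp
qed simp

lemma padic_B_bijective_mod:
  fixes f :: "'p :: prime_card padic_int \<Rightarrow> 'p padic_int"
  assumes "f \<in> padic_B" and bij: "bijective_mod f 2"
  shows "bijective_mod f k"
proof -
  have p: "prime (int CARD('p))" by (rule prime_card_int)
  obtain P where P: "\<And>j. j \<le> max k 2 \<Longrightarrow> induces_mod f j (\<lambda>r. poly P r mod int CARD('p) ^ j)"
    using padic_B_induces_poly_le[OF assms(1)] by blast
  note iff = bijective_mod_iff_inj_modulo[OF P]
  have "bijective_mod f 1" using bijective_mod_mono[OF bij _ P[of 1]] by simp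
  then have "inj_modulo (poly P) (int CARD('p))" using iff[of 1] by simp
  moreover have "inj_modulo (poly P) ((int CARD('p))\<^sup>2)" using bij iff[of 2] by simp
  ultimately have "inj_modulo (poly P) (int CARD('p) ^ k)"
    using p inj_modulo_prime_square_imp_pderiv_nonzero inj_modulo_prime_power_if_pderiv_nonzero
    by blast
  then show ?thesis using iff[of k] by simp
qed

lemma padic_B_transitive_mod:
  fixes f :: "'p :: prime_card padic_int \<Rightarrow> 'p padic_int"
  assumes "f \<in> padic_B" and transitive: "transitive_mod f n"
    and n: "n \<ge> 2" "CARD('p) \<le> 3 \<Longrightarrow> n \<ge> 3"
  shows "transitive_mod f k"
proof -
  obtain P where P: "\<And>j. j \<le> max k n \<Longrightarrow> induces_mod f j (\<lambda>r. poly P r mod int CARD('p) ^ j)"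
    using padic_B_induces_poly_le[OF assms(1)] by blast
  note iff = transitive_mod_iff_full_period[OF P]
  have "full_period (poly P) (CARD('p) ^ j)" if "j \<le> n" for j
    using transitive_mod_mono[OF transitive that P[of j]] iff[of j] that by simp
  then have "full_period (poly P) (CARD('p) ^ k)"
    by (rule full_period_prime_power[OF prime_card _ n])
  then show ?thesis using iff[of k] by simp
qed

lemma padic_B_measure_preserving_iff:
  assumes "f \<in> padic_B"
  shows "measure_preserving f \<longleftrightarrow> bijective_mod f 2"
  using measure_preserving_iff_bijective_mod[OF padic_B_lipschitz[OF assms]]
    padic_B_bijective_mod[OF assms]
  by blast

lemma padic_B_ergodic_iff:
  fixes f :: "'p :: prime_card padic_int \<Rightarrow> 'p padic_int"
  assumes "f \<in> padic_B" and "n \<ge> 2" "CARD('p) \<le> 3 \<Longrightarrow> n \<ge> 3"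
  shows "ergodic f \<longleftrightarrow> transitive_mod f n"
  using ergodic_iff_transitive_mod[OF padic_B_lipschitz[OF assms(1)]]
    padic_B_transitive_mod[OF assms(1) _ assms(2,3)]
  by blast

theorem theorem4p9:
  fixes f :: "'p :: prime_card padic_int \<Rightarrow> 'p padic_int"
  assumes "f \<in> padic_B"
  shows "(measure_preserving f \<longleftrightarrow> bijective_mod f 2) \<and>
    (CARD('p) \<notin> {2, 3} \<longrightarrow> (ergodic f \<longleftrightarrow> transitive_mod f 2)) \<and>
    (CARD('p) \<in> {2, 3} \<longrightarrow> (ergodic f \<longleftrightarrow> transitive_mod f 3))"
proof (intro conjI impI)
  show "measure_preserving f \<longleftrightarrow> bijective_mod f 2"
    using assms by (rule padic_B_measure_preserving_iff)
  assume "CARD('p) \<notin> {2, 3}"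
  then have "CARD('p) > 3" using p_gt_1[where 'p = 'p] by auto
  then show "ergodic f \<longleftrightarrow> transitive_mod f 2" by (intro padic_B_ergodic_iff[OF assms]) auto
next
  show "ergodic f \<longleftrightarrow> transitive_mod f 3" by (intro padic_B_ergodic_iff[OF assms]) auto
qed

end
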